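(* Let $A\in\mathbb{R}^{n\times n}$, $B\in\mathbb{R}^{n\times m}$ with $(A,B)$ stabilizable, let $Q,Q_f\in\mathbb{R}^{n\times n}$ be symmetric positive semidefinite and $R\in\mathbb{R}^{m\times m}$ symmetric positive definite. Let $w_0,w_1,\dots$ be drawn i.i.d. from a distribution $\mathcal{D}$ on $\mathbb{R}^n$ with zero mean, bounded support and covariance $W$. For each $T\ge1$ let $(u_0^*,\dots,u_{T-1}^* )$ be the optimal offline control actions for horizon $T$ (as defined in the context), with resulting states $x_t^*$. Then the infinite-horizon cost of the optimal offline policy is $$\lim_{T\to\infty}\mathbb{E}\left[\frac1T\sum_{t=0}^{T-1}x_t^{*\top}Qx_t^*+u_t^{*\top}Ru_t^*\right]=\operatorname{Tr}(WS)-\sum_{i=0}^{\infty}\operatorname{Tr}\left(WSA(A-BK)^iB(R+B^{\top}PB)^{-1}B^{\top}(A^{\top}-K^{\top}B^{\top})^iA^{\top}S\right),$$ where $P$ is the unique positive semidefinite solution of the algebraic Riccati equation $$P=Q+A^{\top}PA-A^{\top}PB(R+B^{\top}PB)^{-1}B^{\top}PA,$$ $S=P-PB(R+B^{\top}PB)^{-1}B^{\top}P$, and $K=(R+B^{\top}PB)^{-1}B^{\top}PA$.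
   Context: $(A,B)$ is stabilizable if there is $K'\in\mathbb{R}^{m\times n}$ with spectral radius $\rho(A-BK')<1$. Dynamics: $x_0=0$ and $x_{t+1}=Ax_t+Bu_t+w_t$. Given horizon $T$ and the realized noise sequence $w=(w_0,\dots,w_{T-1})$, the optimal offline control actions $(u_0^*,\dots,u_{T-1}^* )$ are the minimizers, over all $(u_0,\dots,u_{T-1})\in(\mathbb{R}^m)^T$ and with full knowledge of $w$, of $\left(\sum_{t=0}^{T-1}x_t^{\top}Qx_t+u_t^{\top}Ru_t\right)+x_T^{\top}Q_fx_T$, where $Q_f$ is a terminal state cost. It is part of the setting that the algebraic Riccati equation has a unique positive semidefinite solution $P$. The gain $K$ is that of the optimal online (causal) infinite-horizon policy $u_t=-Kx_t$. The covariance is $W=\mathbb{E}[w_tw_t^{\top}]$. *)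

theory Defs
  imports "HOL-Probability.Probability"
begin

definition sym_psd :: "real^'n^'n \<Rightarrow> bool" where
  "sym_psd M \<longleftrightarrow> transpose M = M \<and> (\<forall>x. 0 \<le> x \<bullet> (M *v x))"

definition sym_pd :: "real^'n^'n \<Rightarrow> bool" where
  "sym_pd M \<longleftrightarrow> transpose M = M \<and> (\<forall>x. x \<noteq> 0 \<longrightarrow> 0 < x \<bullet> (M *v x))"

(* The class operations * and ^ on vectors and matrices act componentwise,
   so powers with respect to the matrix product need their own function. *)
primrec mat_pow :: "'a::semiring_1^'n^'n \<Rightarrow> nat \<Rightarrow> 'a^'n^'n" where
  "mat_pow M 0 = mat 1"
| "mat_pow M (Suc k) = M ** mat_pow M k"

definition complex_eigenvalues :: "real^'n^'n \<Rightarrow> complex set" where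
  "complex_eigenvalues M =
     {z. \<exists>v. v \<noteq> 0 \<and> map_matrix complex_of_real M *v v = z *s v}"

(* The set of eigenvalues is finite and nonempty, so the maximum exists. *)
definition spectral_radius :: "real^'n^'n \<Rightarrow> real" where
  "spectral_radius M = Max (norm ` complex_eigenvalues M)"

definition stabilizable :: "real^'n^'n \<Rightarrow> real^'m^'n \<Rightarrow> bool" where
  "stabilizable A B \<longleftrightarrow> (\<exists>K :: real^'n^'m. spectral_radius (A - B ** K) < 1)"

primrec lin_state ::
  "real^'n^'n \<Rightarrow> real^'m^'n \<Rightarrow> (nat \<Rightarrow> real^'n) \<Rightarrow> (nat \<Rightarrow> real^'m) \<Rightarrow> nat \<Rightarrow> real^'n"
where
  "lin_state A B w u 0 = 0"
| "lin_state A B w u (Suc t) = A *v lin_state A B w u t + B *v u t + w t"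

definition running_cost ::
  "real^'n^'n \<Rightarrow> real^'m^'n \<Rightarrow> real^'n^'n \<Rightarrow> real^'m^'m \<Rightarrow> nat \<Rightarrow>
   (nat \<Rightarrow> real^'n) \<Rightarrow> (nat \<Rightarrow> real^'m) \<Rightarrow> real"
where
  "running_cost A B Q R T w u =
     (\<Sum>t<T. lin_state A B w u t \<bullet> (Q *v lin_state A B w u t) + u t \<bullet> (R *v u t))"

(* Control sequences and noise realizations of horizon T are represented by
   functions on nat; running_cost and horizon_cost depend only on the
   components with index less than T. *)
definition horizon_cost ::
  "real^'n^'n \<Rightarrow> real^'m^'n \<Rightarrow> real^'n^'n \<Rightarrow> real^'m^'m \<Rightarrow> real^'n^'n \<Rightarrow> nat \<Rightarrow>
   (nat \<Rightarrow> real^'n) \<Rightarrow> (nat \<Rightarrow> real^'m) \<Rightarrow> real"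
where
  "horizon_cost A B Q R Qf T w u =
     running_cost A B Q R T w u
     + lin_state A B w u T \<bullet> (Qf *v lin_state A B w u T)"

definition offline_optimal ::
  "real^'n^'n \<Rightarrow> real^'m^'n \<Rightarrow> real^'n^'n \<Rightarrow> real^'m^'m \<Rightarrow> real^'n^'n \<Rightarrow> nat \<Rightarrow>
   (nat \<Rightarrow> real^'n) \<Rightarrow> (nat \<Rightarrow> real^'m) \<Rightarrow> bool"
where
  "offline_optimal A B Q R Qf T w u \<longleftrightarrow>
     is_arg_min (horizon_cost A B Q R Qf T w) (\<lambda>_. True) u"

definition riccati_eq ::
  "real^'n^'n \<Rightarrow> real^'m^'n \<Rightarrow> real^'n^'n \<Rightarrow> real^'m^'m \<Rightarrow> real^'n^'n \<Rightarrow> bool"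
where
  "riccati_eq A B Q R P \<longleftrightarrow>
     P = Q + transpose A ** P ** A
         - transpose A ** P ** B ** matrix_inv (R + transpose B ** P ** B)
           ** transpose B ** P ** A"

definition measure_support :: "'a::topological_space measure \<Rightarrow> 'a set" where
  "measure_support D = {x. \<forall>U. open U \<and> x \<in> U \<longrightarrow> emeasure D U > 0}"

end

theory Submission
  imports Defs "HOL-Complex_Analysis.Complex_Analysis" "HOL-Real_Asymp.Real_Asymp"
begin

text \<open>
  The dynamics are linear and the costs quadratic, so dynamic programming can be carried out exactly
  even for a controller that knows the noise. Let P(k) be the k-th iterate of the Riccati map from the
  terminal matrix. With k steps to go the value of a state x is
  x \<bullet> P(k) x + 2 v(k) \<bullet> x + q(k), where the costate v(k) is a linear function of the noise still to
  come. Completing the square in the control (bellman_identity) and telescoping over the horizon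
  (horizon_cost_eq) writes the cost of an arbitrary control sequence as q(T) plus squared deviations
  from one feedback law. Hence the minimizer is unique and depends measurably on the noise, and the
  minimum from the initial state 0 is q(T). Taking expectations uses only the second moments of the
  noise (expectation_optimal_cost): the stage followed by k others contributes Tr(W S(k)), what an
  online controller pays, minus Tr(H(k) C(k)), what foresight saves, where C(k) is the covariance of
  v(k), S(k) is the Schur complement in the Riccati map at P(k), and
  H(k) = B (R + B' P(k) B)^-1 B'. If the terminal matrix is P itself, C(k) is a partial sum and the
  saving is exactly the k-th partial sum of the series in the theorem
  (expected_stage_stationary).

  It remains to see that the terminal cost does not influence the average. The closed loop A - B K
  need not be stable under the hypotheses: it can have eigenvalues on the unit circle, along directions
  that P does not see. Then convergence of the covariances C(k) is not immediate and the optimal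
  final state may be large. Two one-sided arguments avoid both issues.

  From above, a stabilizing gain provides, through a Stein equation, a matrix Z that dominates the
  terminal cost and does not increase under the Riccati map. Its iterates decrease to a positive
  semidefinite fixed point, which is P by uniqueness (dominating_terminal_cost). The running cost is
  at most the optimal cost for Z, and dropping all but the N most recent noise vectors from C(k) only
  lowers the saving; the truncated saving converges to the N-th partial sum of the series
  (mean_cost_upper). Since costs are nonnegative, this bounds the partial sums and gives
  summability as well.

  From below, the iterates from 0 increase to a fixed point, again P. They see the same directions
  as P after finitely many steps, so P is at most twice one of them
  (P_dominated_by_finite_horizon). The form x \<bullet> P x at a state of the trajectory is therefore
  controlled by the running cost over the next k steps. Stopping the trajectory at each time s of a
  window of length m and comparing with the optimal cost for terminal matrix P bounds m times the
  running cost from below, up to errors that become negligible as T and then m grow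
  (optimal_cost_window_le, mean_cost_lower). Letting first T and then m tend to infinity gives the
  matching bound.
\<close>

(* Transposes arise from moving matrices across inner products; rewriting them into row-vector
   products would break that normal form. *)
declare transpose_matrix_vector [simp del] vector_transpose_matrix [simp del]
(* The dollar sign is used for vector components only. *)
no_notation fps_nth (infixl "$" 75)

section \<open>Powers of a matrix of spectral radius below one\<close>

text \<open>
  Up to a factor z and the substitution of 1/z this is the characteristic matrix. Its inverse is the
  generating function of the powers of F, so their decay can be read off from a radius of
  convergence.
\<close>

definition resolvent_matrix :: "complex^'n^'n \<Rightarrow> complex \<Rightarrow> complex^'n^'n" where
  "resolvent_matrix F z = (\<chi> i j. (if i = j then 1 else 0) - z * F $ i $ j)"

lemma resolvent_matrix_mult:
  "(resolvent_matrix F z *v x) $ i = x $ i - z * (F *v x) $ i"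
proof -
  have "((if i = j then 1 else 0) - z * F $ i $ j) * x $ j
      = (if i = j then x $ j else 0) - z * (F $ i $ j * x $ j)" for j
    by (simp add: algebra_simps)
  then show ?thesis
    by (simp add: resolvent_matrix_def matrix_vector_mult_def sum_subtractf sum_distrib_left)
qed

text \<open>
  A nonzero polynomial has finitely many roots. So there are finitely many eigenvalues, and roots
  outside the closed unit disc keep a positive distance from it. The polynomial does not vanish
  identically because its value at 0 is the determinant of the identity.
\<close>

lemma det_resolvent_matrix_poly:
  obtains p where "p \<noteq> 0" "\<And>z. det (resolvent_matrix F z) = poly p z"
proof
  let ?p = "\<Sum>q | q permutes UNIV.
      of_int (sign q) * (\<Prod>i\<in>UNIV. [:if i = q i then 1 else 0, - F $ i $ q i:])"
  show eq: "det (resolvent_matrix F z) = poly ?p z" for z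
    by (simp add: det_def resolvent_matrix_def poly_sum poly_prod of_int_poly cong: if_cong)
  have "resolvent_matrix F 0 = mat 1"
    by (simp add: resolvent_matrix_def mat_def)
  then have "poly ?p 0 \<noteq> 0"
    using eq[of 0] by simp
  then show "?p \<noteq> 0"
    by (metis poly_0)
qed

lemma det_resolvent_matrix_eq_0_iff:
  "det (resolvent_matrix F z) = 0 \<longleftrightarrow> (\<exists>v. v \<noteq> 0 \<and> v = z *s (F *v v))"
proof -
  have "det (resolvent_matrix F z) \<noteq> 0 \<longleftrightarrow> (\<forall>v. resolvent_matrix F z *v v = 0 \<longrightarrow> v = 0)"
    unfolding invertible_det_nz[symmetric] invertible_left_inverse
    by (rule matrix_left_invertible_ker)
  moreover have "resolvent_matrix F z *v v = 0 \<longleftrightarrow> v = z *s (F *v v)" for v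
    by (auto simp: vec_eq_iff resolvent_matrix_mult)
  ultimately show ?thesis
    by auto
qed

text \<open>
  Without finiteness, the maximum that defines the spectral radius would say nothing about
  individual eigenvalues. Nonzero eigenvalues are reciprocals of roots of the determinant above.
\<close>

lemma finite_complex_eigenvalues: "finite (complex_eigenvalues M)"
proof -
  define F where "F = map_matrix complex_of_real M"
  obtain p where p: "p \<noteq> 0" "\<And>z. det (resolvent_matrix F z) = poly p z"
    using det_resolvent_matrix_poly[of F] by blast
  have root: "z = 0 \<or> poly p (inverse z) = 0" if ev: "z \<in> complex_eigenvalues M" for z
  proof (cases "z = 0")
    case False
    from ev obtain v where "v \<noteq> 0" "F *v v = z *s v"
      by (auto simp: complex_eigenvalues_def F_def)
    with False have "v = inverse z *s (F *v v)"
      by (simp add: vector_smult_assoc)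
    with \<open>v \<noteq> 0\<close> show ?thesis
      using det_resolvent_matrix_eq_0_iff[of F "inverse z"] p(2) by metis
  qed auto
  then have "complex_eigenvalues M \<subseteq> insert 0 (inverse ` {z. poly p z = 0})"
    proof (intro subsetI)
    fix z assume "z \<in> complex_eigenvalues M"
    then have "z = 0 \<or> poly p (inverse z) = 0"
      by (rule root)
    then show "z \<in> insert 0 (inverse ` {z. poly p z = 0})"
      by (metis (mono_tags) image_eqI insertCI inverse_inverse_eq mem_Collect_eq)
  qed
  then show ?thesis
    using poly_roots_finite[OF p(1)] by (meson finite_imageI finite_insert finite_subset)
qed

lemma eigenvalue_norm_le_spectral_radius:
  "z \<in> complex_eigenvalues M \<Longrightarrow> norm z \<le> spectral_radius M"
  unfolding spectral_radius_def by (intro Max_ge finite_imageI finite_complex_eigenvalues imageI)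

lemma det_resolvent_matrix_nonzero_disc:
  assumes "\<And>z. norm z \<le> 1 \<Longrightarrow> det (resolvent_matrix F z) \<noteq> 0"
  obtains r where "r > 1" "\<And>z. norm z < r \<Longrightarrow> det (resolvent_matrix F z) \<noteq> 0"
proof -
  obtain p where p: "p \<noteq> 0" "\<And>z. det (resolvent_matrix F z) = poly p z"
    using det_resolvent_matrix_poly[of F] by blast
  let ?N = "insert 2 (norm ` {z. poly p z = 0})"
  have fin: "finite ?N"
    using poly_roots_finite[OF p(1)] by auto
  have "\<forall>x\<in>?N. x > 1"
    using assms p(2) by force
  then have "Min ?N > 1"
    using fin by (subst Min_gr_iff) auto
  moreover have "poly p z \<noteq> 0" if "norm z < Min ?N" for z
    using that fin by (subst (asm) Min_gr_iff) auto
  ultimately show thesis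
    using that p(2) by metis
qed

text \<open>
  Cramer's rule makes the solution x(z) of (I - z F) x(z) = b a quotient of polynomials whose
  denominator has no zero in a disc of radius larger than 1. The relation x = b + z F x forces the
  Taylor coefficients of x to be the vectors F^n b, and a power series converges absolutely at the
  point 1 inside its disc of convergence.
\<close>

lemma summable_matrix_powers_vec:
  fixes F :: "complex^'n^'n"
  assumes "\<And>z. norm z \<le> 1 \<Longrightarrow> det (resolvent_matrix F z) \<noteq> 0"
  shows "summable (\<lambda>k. norm ((mat_pow F k *v b) $ i))"
proof -
  obtain r where r: "r > 1" "\<And>z. norm z < r \<Longrightarrow> det (resolvent_matrix F z) \<noteq> 0"
    using det_resolvent_matrix_nonzero_disc[OF assms] by blast
  define x :: "complex \<Rightarrow> complex^'n" where
    "x z = (\<chi> k. det (\<chi> i j. if j = k then b $ i else resolvent_matrix F z $ i $ j)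
                  / det (resolvent_matrix F z))" for z
  have x_eq: "x z $ k = b $ k + z * (F *v x z) $ k" if "norm z < r" for z k
  proof -
    have "resolvent_matrix F z *v x z = b"
      using cramer[OF r(2)[OF that]] by (simp add: x_def)
    then show ?thesis
      using resolvent_matrix_mult[of F z "x z" k] by simp
  qed
  have det_holo: "(\<lambda>z. det (M z)) holomorphic_on S"
    if "\<And>i j. (\<lambda>z. M z $ i $ j) holomorphic_on S" for M :: "complex \<Rightarrow> complex^'n^'n" and S
    unfolding det_def by (intro holomorphic_intros that)
  have res_holo: "(\<lambda>z. resolvent_matrix F z $ i $ j) holomorphic_on S" for i j S
    unfolding resolvent_matrix_def vec_lambda_beta by (intro holomorphic_intros)
  have entry_holo: "(\<lambda>z. (\<chi> i j. if j = k then b $ i else resolvent_matrix F z $ i $ j) $ i $ j)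
      holomorphic_on S" for i j k S
    using res_holo by (cases "j = k") simp_all
  have holo: "(\<lambda>z. x z $ k) holomorphic_on ball 0 r" for k
    unfolding x_def vec_lambda_beta
    by (intro holomorphic_on_divide det_holo res_holo entry_holo r(2)) simp
  define X where "X k = fps_expansion (\<lambda>z. x z $ k) 0" for k
  have X: "(\<lambda>z. x z $ k) has_fps_expansion X k" for k
    unfolding X_def using r(1) by (intro has_fps_expansion_fps_expansion[OF _ _ holo]) auto
  have X_eq: "X k = fps_const (b $ k) + fps_X * (\<Sum>j\<in>UNIV. fps_const (F $ k $ j) * X j)" for k
  proof (rule fps_expansion_unique_complex[OF X])
    have "(\<lambda>z. b $ k + z * (\<Sum>j\<in>UNIV. F $ k $ j * x z $ j)) has_fps_expansion
        fps_const (b $ k) + fps_X * (\<Sum>j\<in>UNIV. fps_const (F $ k $ j) * X j)"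
      by (intro fps_expansion_intros X)
    also have "?this \<longleftrightarrow> (\<lambda>z. x z $ k) has_fps_expansion
        fps_const (b $ k) + fps_X * (\<Sum>j\<in>UNIV. fps_const (F $ k $ j) * X j)"
    proof (rule has_fps_expansion_cong)
      have "eventually (\<lambda>z. z \<in> ball 0 r) (nhds (0::complex))"
        using r(1) by (intro eventually_nhds_in_open) auto
      then show "\<forall>\<^sub>F z in nhds 0. b $ k + z * (\<Sum>j\<in>UNIV. F $ k $ j * x z $ j) = x z $ k"
        proof eventually_elim
          case (elim z)
          then show ?case
            using x_eq[of z k] by (simp add: matrix_vector_mult_def)
        qed
    qed simp
    finally show "(\<lambda>z. x z $ k) has_fps_expansion
        fps_const (b $ k) + fps_X * (\<Sum>j\<in>UNIV. fps_const (F $ k $ j) * X j)" .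
  qed
  have coeff: "fps_nth (X k) n = (mat_pow F n *v b) $ k" for k n
  proof (induction n arbitrary: k)
    case 0
    show ?case
      by (subst X_eq) simp
  next
    case (Suc n)
    have "fps_nth (X k) (Suc n) = (\<Sum>j\<in>UNIV. F $ k $ j * fps_nth (X j) n)"
      by (subst X_eq) (simp add: fps_sum_nth)
    then show ?case
      by (simp add: Suc matrix_vector_mul_assoc[symmetric]) (simp add: matrix_vector_mult_def)
  qed
  have "fps_conv_radius (X i) \<ge> ereal r"
    unfolding X_def using holo[of i] by (intro conv_radius_fps_expansion) auto
  moreover have "ereal (norm (1::complex)) < ereal r"
    using r(1) by simp
  ultimately have "ereal (norm (1::complex)) < fps_conv_radius (X i)"
    by (rule less_le_trans[rotated])
  from norm_summable_fps[OF this] show ?thesis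
    by (simp add: coeff)
qed

lemma summable_norm_mat_pow:
  fixes F :: "real^'n^'n"
  assumes "spectral_radius F < 1"
  shows "summable (\<lambda>k. norm (mat_pow F k *v b))"
proof -
  define C where "C = map_matrix complex_of_real F"
  have vec: "C *v (\<chi> i. complex_of_real (y $ i)) = (\<chi> i. complex_of_real ((F *v y) $ i))" for y
    by (simp add: C_def vec_eq_iff matrix_vector_mult_def map_matrix_def)
  have pow: "mat_pow C k *v (\<chi> i. complex_of_real (b $ i))
      = (\<chi> i. complex_of_real ((mat_pow F k *v b) $ i))" for k
    by (induction k) (simp_all add: matrix_vector_mul_assoc[symmetric] vec)
  have nz: "det (resolvent_matrix C z) \<noteq> 0" if "norm z \<le> 1" for z
  proof
    assume "det (resolvent_matrix C z) = 0"
    then obtain v where v: "v \<noteq> 0" "v = z *s (C *v v)"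
      by (auto simp: det_resolvent_matrix_eq_0_iff)
    then have "z \<noteq> 0"
      by auto
    then have "C *v v = inverse z *s v"
      by (subst v(2)) (simp add: vector_smult_assoc)
    then have "inverse z \<in> complex_eigenvalues F"
      using v(1) by (auto simp: complex_eigenvalues_def C_def)
    then have "norm (inverse z) < 1"
      using eigenvalue_norm_le_spectral_radius[of "inverse z" F] assms by linarith
    with that \<open>z \<noteq> 0\<close> show False
      by (simp add: norm_inverse one_less_inverse_iff inverse_less_1_iff)
  qed
  have comp: "summable (\<lambda>k. norm ((mat_pow F k *v b) $ i))" for i
    using summable_matrix_powers_vec[OF nz, of "\<chi> i. complex_of_real (b $ i)" i]
    by (simp add: pow)
  show ?thesis
  proof (rule summable_comparison_test')
    show "summable (\<lambda>k. \<Sum>i\<in>UNIV. norm ((mat_pow F k *v b) $ i))"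
      by (intro summable_sum comp)
    show "norm (norm (mat_pow F k *v b)) \<le> (\<Sum>i\<in>UNIV. norm ((mat_pow F k *v b) $ i))" for k
      using norm_le_l1_cart[of "mat_pow F k *v b"] by simp
  qed
qed

section \<open>Symmetric positive semidefinite matrices\<close>

lemma inner_matrix_left: "(M *v x) \<bullet> y = x \<bullet> (transpose M *v y)" for M :: "real^'n^'m"
  by (metis dot_lmul_matrix inner_commute transpose_matrix_vector)

lemma inner_matrix_symmetric:
  "transpose M = M \<Longrightarrow> (M *v x) \<bullet> y = x \<bullet> (M *v y)" for M :: "real^'n^'n"
  by (metis inner_matrix_left)

lemma sym_psd_inner: "sym_psd M \<Longrightarrow> (M *v x) \<bullet> y = x \<bullet> (M *v y)"
  by (simp add: sym_psd_def inner_matrix_symmetric)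

lemma transpose_add: "transpose (M + N) = transpose M + transpose N"
  by (simp add: transpose_def vec_eq_iff)

lemma transpose_diff: "transpose (M - N) = transpose M - transpose N"
  for M :: "'a::group_add^'n^'m"
  by (simp add: transpose_def vec_eq_iff)

lemma symmetric_matrixI:
  fixes M :: "real^'n^'n"
  assumes "\<And>x y. (M *v x) \<bullet> y = x \<bullet> (M *v y)"
  shows "transpose M = M"
proof -
  have "x \<bullet> (transpose M *v y) = x \<bullet> (M *v y)" for x y
    using assms by (simp add: inner_matrix_left[symmetric])
  then show ?thesis
    by (simp add: matrix_eq vector_eq_rdot inner_commute) (metis inner_commute vector_eq_rdot)
qed

lemma sym_psdI:
  assumes "\<And>x y. (M *v x) \<bullet> y = x \<bullet> (M *v y)" "\<And>x. 0 \<le> x \<bullet> (M *v x)"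
  shows "sym_psd M"
  using assms by (simp add: sym_psd_def symmetric_matrixI)

lemma matrix_vector_mul_minus: "M *v (- x) = - (M *v x)" for M :: "real^'n^'m"
  by (metis diff_0 matrix_vector_mult_0_right matrix_vector_mult_diff_distrib)

lemma matrix_vector_mul_scaleR: "M *v (c *\<^sub>R x) = c *\<^sub>R (M *v x)" for M :: "real^'n^'m"
  by (simp add: scaleR_matrix_vector_assoc vec_eq_iff matrix_vector_mult_def sum_distrib_left mult_ac)

lemma sym_psd_add: "sym_psd M \<Longrightarrow> sym_psd N \<Longrightarrow> sym_psd (M + N)"
  by (simp add: sym_psd_def transpose_add matrix_vector_mult_add_rdistrib inner_add_right)

lemma sym_psd_congruence:
  fixes N :: "real^'m^'n"
  assumes "sym_psd M"
  shows "sym_psd (transpose N ** M ** N)"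
  using assms
  by (intro sym_psdI)
     (simp_all add: matrix_vector_mul_assoc[symmetric] inner_matrix_left sym_psd_inner
        , simp_all add: inner_matrix_left[symmetric] sym_psd_def)

lemma sym_pd_imp_psd: "sym_pd M \<Longrightarrow> sym_psd M"
  unfolding sym_pd_def sym_psd_def
  by (metis inner_zero_left less_eq_real_def)

lemma sym_pd_matrix_inv:
  fixes M :: "real^'m^'m"
  assumes "sym_pd M"
  shows "M ** matrix_inv M = mat 1" "matrix_inv M ** M = mat 1" "sym_psd (matrix_inv M)"
proof -
  have "x = 0" if "M *v x = 0" for x
    using assms that unfolding sym_pd_def by (metis inner_zero_right less_irrefl)
  then have "\<exists>M'. M' ** M = mat 1"
    unfolding matrix_left_invertible_ker by blast
  then have "\<exists>M'. M ** M' = mat 1 \<and> M' ** M = mat 1"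
    using matrix_left_right_inverse by blast
  then have *: "M ** matrix_inv M = mat 1 \<and> matrix_inv M ** M = mat 1"
    unfolding matrix_inv_def by (rule someI_ex)
  then show "M ** matrix_inv M = mat 1" "matrix_inv M ** M = mat 1"
    by auto
  have cancel: "M *v (matrix_inv M *v x) = x" for x
    using * by (simp add: matrix_vector_mul_assoc)
  have sym: "(M *v x) \<bullet> y = x \<bullet> (M *v y)" for x y
    using assms by (simp add: sym_psd_inner sym_pd_imp_psd)
  show "sym_psd (matrix_inv M)"
  proof (rule sym_psdI)
    show "(matrix_inv M *v x) \<bullet> y = x \<bullet> (matrix_inv M *v y)" for x y
      using sym[of "matrix_inv M *v x" "matrix_inv M *v y"] by (simp add: cancel)
    show "0 \<le> x \<bullet> (matrix_inv M *v x)" for x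
      using sym_pd_imp_psd[OF assms] cancel[of x] unfolding sym_psd_def
      by (metis inner_commute)
  qed
qed

section \<open>Completing the square in one step\<close>

text \<open>
  The data of one stage of the regulator, kept apart from stabilizability and the fixed point:
  the identities of finite-horizon dynamic programming hold for any such data.
\<close>

locale lqr =
  fixes A :: "real^'n^'n" and B :: "real^'m^'n" and Q :: "real^'n^'n" and R :: "real^'m^'m"
  assumes Q_psd: "sym_psd Q" and R_pd: "sym_pd R"
begin

definition gram :: "real^'n^'n \<Rightarrow> real^'m^'m" where
  "gram X = R + transpose B ** X ** B"

definition ctrl :: "real^'n^'n \<Rightarrow> real^'n^'n" where
  "ctrl X = B ** matrix_inv (gram X) ** transpose B"

text \<open>
  Minimizing (y + B u) \<bullet> X (y + B u) + u \<bullet> R u over u leaves y \<bullet> schur X y, so this is the Schur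
  complement of the control block; at the fixed point of the Riccati map it is the matrix S of the
  theorem.
\<close>

definition schur :: "real^'n^'n \<Rightarrow> real^'n^'n" where
  "schur X = X - X ** B ** matrix_inv (gram X) ** transpose B ** X"

definition gain :: "real^'n^'n \<Rightarrow> real^'n^'m" where
  "gain X = matrix_inv (gram X) ** transpose B ** X ** A"

definition closed_loop :: "real^'n^'n \<Rightarrow> real^'n^'n" where
  "closed_loop X = A - B ** gain X"

definition riccati :: "real^'n^'n \<Rightarrow> real^'n^'n" where
  "riccati X = Q + transpose A ** schur X ** A"

text \<open>
  The control that minimizes u \<bullet> R u + z \<bullet> X z + 2 v \<bullet> z at z = y + B u. Here y is the next state
  before control, noise included: an offline controller sees the noise of the current step.
\<close>

definition policy :: "real^'n^'n \<Rightarrow> real^'n \<Rightarrow> real^'n \<Rightarrow> real^'m" where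
  "policy X v y = - (matrix_inv (gram X) *v (transpose B *v (X *v y + v)))"

text \<open>
  The part of the minimal stage cost that does not depend on the state. The last term is what
  knowledge of the future noise, summarized in v, saves.
\<close>

definition offset :: "real^'n^'n \<Rightarrow> real^'n \<Rightarrow> real^'n \<Rightarrow> real" where
  "offset X v w = w \<bullet> (schur X *v w) + 2 * (v \<bullet> (w - ctrl X *v (X *v w))) - v \<bullet> (ctrl X *v v)"

text \<open>
  The linear part of the value function one step earlier in time.
\<close>

definition costate_step :: "real^'n^'n \<Rightarrow> real^'n \<Rightarrow> real^'n \<Rightarrow> real^'n" where
  "costate_step X v w = transpose (closed_loop X) *v v + transpose A *v (schur X *v w)"

lemma gram_form: "u \<bullet> (gram X *v u) = u \<bullet> (R *v u) + (B *v u) \<bullet> (X *v (B *v u))"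
  by (simp add: gram_def matrix_vector_mult_add_rdistrib inner_add_right
        matrix_vector_mul_assoc[symmetric] inner_matrix_left)

lemma gram_pd:
  assumes "sym_psd X"
  shows "sym_pd (gram X)"
proof -
  have "sym_psd (transpose B ** X ** B)"
    using assms by (rule sym_psd_congruence)
  then show ?thesis
    using R_pd
    by (auto simp: gram_def sym_pd_def sym_psd_def transpose_add matrix_vector_mult_add_rdistrib
        inner_add_right intro: add_pos_nonneg)
qed

lemma gram_inverse:
  assumes "sym_psd X"
  shows "gram X *v (matrix_inv (gram X) *v u) = u"
  using sym_pd_matrix_inv(1)[OF gram_pd[OF assms]] by (simp add: matrix_vector_mul_assoc)

lemma ctrl_psd:
  assumes "sym_psd X"
  shows "sym_psd (ctrl X)"
  using sym_psd_congruence[OF sym_pd_matrix_inv(3)[OF gram_pd[OF assms]], of "transpose B"]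
  by (simp add: ctrl_def)

lemma schur_mult: "schur X *v y = X *v y - X *v (ctrl X *v (X *v y))"
  by (simp add: schur_def ctrl_def matrix_vector_mult_diff_rdistrib matrix_vector_mul_assoc
        matrix_mul_assoc)

lemma closed_loop_mult: "closed_loop X *v x = A *v x - ctrl X *v (X *v (A *v x))"
  by (simp add: closed_loop_def gain_def ctrl_def matrix_vector_mult_diff_rdistrib
      matrix_vector_mul_assoc matrix_mul_assoc)

lemma schur_sym:
  assumes "sym_psd X"
  shows "transpose (schur X) = schur X"
proof (rule symmetric_matrixI)
  show "(schur X *v x) \<bullet> y = x \<bullet> (schur X *v y)" for x y
    using assms
    by (simp add: schur_mult inner_diff_left inner_diff_right sym_psd_inner ctrl_psd)
qed

text \<open>
  With h = B' (X y + v) the left-hand side is u \<bullet> gram X u + 2 h \<bullet> u plus terms free of u, and the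
  policy is - gram X ^-1 h. The completed square leaves - h \<bullet> gram X ^-1 h, which is the form of ctrl X
  at X y + v.
\<close>

lemma completing_square:
  assumes X: "sym_psd X"
  shows "u \<bullet> (R *v u) + (y + B *v u) \<bullet> (X *v (y + B *v u)) + 2 * (v \<bullet> (y + B *v u))
    = y \<bullet> (schur X *v y) + 2 * (v \<bullet> (y - ctrl X *v (X *v y))) - v \<bullet> (ctrl X *v v)
      + (u - policy X v y) \<bullet> (gram X *v (u - policy X v y))"
proof -
  define h where "h = transpose B *v (X *v y + v)"
  define g where "g = matrix_inv (gram X) *v h"
  have Gg: "gram X *v g = h"
    by (simp add: g_def gram_inverse X)
  have Gsym: "(gram X *v a) \<bullet> b = a \<bullet> (gram X *v b)" for a b
    using sym_psd_inner sym_pd_imp_psd gram_pd X by blast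
  have pol: "policy X v y = - g"
    by (simp only: policy_def g_def h_def)
  have square: "(u - policy X v y) \<bullet> (gram X *v (u - policy X v y))
      = u \<bullet> (gram X *v u) + 2 * (u \<bullet> h) + g \<bullet> h"
    using Gsym[of g u]
    by (simp add: pol matrix_vector_right_distrib inner_add_left inner_add_right Gg inner_commute)
  have "B *v g = ctrl X *v (X *v y + v)"
    by (simp only: g_def h_def ctrl_def matrix_vector_mul_assoc matrix_mul_assoc)
  moreover have "g \<bullet> h = (X *v y + v) \<bullet> (B *v g)"
    using inner_matrix_left[of "transpose B" "X *v y + v" g]
    by (simp add: h_def[symmetric] inner_commute)
  ultimately have "g \<bullet> h = (X *v y + v) \<bullet> (ctrl X *v (X *v y + v))"
    by simp
  also have "\<dots> = y \<bullet> (X *v (ctrl X *v (X *v y))) + 2 * (v \<bullet> (ctrl X *v (X *v y)))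
      + v \<bullet> (ctrl X *v v)"
    using sym_psd_inner[OF ctrl_psd[OF X], of "X *v y" v]
    by (simp add: inner_add_left inner_add_right matrix_vector_right_distrib sym_psd_inner[OF X]
        inner_commute)
  finally have gh: "g \<bullet> h = \<dots>" .
  have uh: "u \<bullet> h = (B *v u) \<bullet> (X *v y) + v \<bullet> (B *v u)"
    by (simp add: h_def inner_matrix_left[symmetric] inner_add_right inner_commute)
  have "(B *v u) \<bullet> (X *v y) = y \<bullet> (X *v (B *v u))"
    using sym_psd_inner[OF X, of y "B *v u"] by (simp add: inner_commute)
  then show ?thesis
    unfolding square gh
    by (simp add: uh gram_form schur_mult inner_diff_right inner_add_left inner_add_right
        matrix_vector_right_distrib)
qed

text \<open>
  One step of dynamic programming for a value function with a linear term. It is an identity for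
  every control rather than a statement about the minimum, so that it can be summed along an
  arbitrary trajectory.
\<close>

lemma bellman_identity:
  assumes X: "sym_psd X" and z: "z = A *v x + B *v u + w"
  shows "x \<bullet> (Q *v x) + u \<bullet> (R *v u) + z \<bullet> (X *v z) + 2 * (v \<bullet> z)
    = x \<bullet> (riccati X *v x) + 2 * (costate_step X v w \<bullet> x) + offset X v w
      + (u - policy X v (A *v x + w)) \<bullet> (gram X *v (u - policy X v (A *v x + w)))"
proof -
  let ?y = "A *v x + w"
  have z': "z = ?y + B *v u"
    by (simp add: z)
  have S: "(schur X *v a) \<bullet> b = a \<bullet> (schur X *v b)" for a b
    by (simp add: schur_sym[OF X] inner_matrix_symmetric)
  have "?y \<bullet> (schur X *v ?y)
      = (A *v x) \<bullet> (schur X *v (A *v x)) + 2 * ((A *v x) \<bullet> (schur X *v w)) + w \<bullet> (schur X *v w)"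
    using S[of w "A *v x"]
    by (simp add: inner_add_left inner_add_right matrix_vector_right_distrib inner_commute)
  moreover have "x \<bullet> (riccati X *v x) = x \<bullet> (Q *v x) + (A *v x) \<bullet> (schur X *v (A *v x))"
    by (simp add: riccati_def matrix_vector_mult_add_rdistrib inner_add_right
        matrix_vector_mul_assoc[symmetric] inner_matrix_left)
  moreover have "costate_step X v w \<bullet> x
      = v \<bullet> (A *v x - ctrl X *v (X *v (A *v x))) + (A *v x) \<bullet> (schur X *v w)"
    using inner_matrix_left[of "transpose (closed_loop X)" v x]
      inner_matrix_left[of "transpose A" "schur X *v w" x]
    by (simp add: costate_step_def inner_add_left inner_add_right closed_loop_mult inner_commute)
  moreover have "v \<bullet> (?y - ctrl X *v (X *v ?y))
      = v \<bullet> (A *v x - ctrl X *v (X *v (A *v x))) + v \<bullet> (w - ctrl X *v (X *v w))"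
    by (simp add: inner_add_right inner_diff_right matrix_vector_right_distrib)
  ultimately show ?thesis
    using completing_square[OF X, of u ?y v] by (simp add: z' offset_def)
qed

lemma riccati_form:
  assumes "sym_psd X"
  shows "x \<bullet> (Q *v x) + u \<bullet> (R *v u) + (A *v x + B *v u) \<bullet> (X *v (A *v x + B *v u))
    = x \<bullet> (riccati X *v x)
      + (u - policy X 0 (A *v x)) \<bullet> (gram X *v (u - policy X 0 (A *v x)))"
  using bellman_identity[OF assms, of "A *v x + B *v u" x u 0 0]
  by (simp add: costate_step_def offset_def matrix_vector_mult_0_right)

lemma gram_form_nonneg: "sym_psd X \<Longrightarrow> 0 \<le> u \<bullet> (gram X *v u)"
  using sym_pd_imp_psd[OF gram_pd] by (auto simp: sym_psd_def)

lemma gram_form_eq_0: "sym_psd X \<Longrightarrow> u \<bullet> (gram X *v u) = 0 \<longleftrightarrow> u = 0"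
  using gram_pd by (force simp: sym_pd_def)

lemma riccati_le:
  assumes "sym_psd X"
  shows "x \<bullet> (riccati X *v x)
    \<le> x \<bullet> (Q *v x) + u \<bullet> (R *v u) + (A *v x + B *v u) \<bullet> (X *v (A *v x + B *v u))"
  using riccati_form[OF assms] gram_form_nonneg[OF assms] by (simp add: le_add_same_cancel1)

lemma riccati_attained:
  assumes "sym_psd X"
  obtains u where "x \<bullet> (riccati X *v x)
    = x \<bullet> (Q *v x) + u \<bullet> (R *v u) + (A *v x + B *v u) \<bullet> (X *v (A *v x + B *v u))"
  using riccati_form[OF assms, of x "policy X 0 (A *v x)"] that[of "policy X 0 (A *v x)"]
  by simp

lemma riccati_psd:
  assumes X: "sym_psd X"
  shows "sym_psd (riccati X)"
  unfolding sym_psd_def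
proof (intro conjI allI)
  show "transpose (riccati X) = riccati X"
    using Q_psd
    by (simp add: riccati_def transpose_add matrix_transpose_mul schur_sym[OF X] sym_psd_def
        matrix_mul_assoc)
  show "0 \<le> x \<bullet> (riccati X *v x)" for x
  proof -
    obtain u where "x \<bullet> (riccati X *v x)
      = x \<bullet> (Q *v x) + u \<bullet> (R *v u) + (A *v x + B *v u) \<bullet> (X *v (A *v x + B *v u))"
      using riccati_attained[OF X] .
    then show ?thesis
      using Q_psd sym_pd_imp_psd[OF R_pd] X by (simp add: sym_psd_def)
  qed
qed

text \<open>
  The form of riccati X is a minimum over controls of expressions that are monotone in X.
\<close>

lemma riccati_mono:
  assumes X: "sym_psd X" and Y: "sym_psd Y" and le: "\<And>x. x \<bullet> (X *v x) \<le> x \<bullet> (Y *v x)"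
  shows "x \<bullet> (riccati X *v x) \<le> x \<bullet> (riccati Y *v x)"
proof -
  obtain u where u: "x \<bullet> (riccati Y *v x)
    = x \<bullet> (Q *v x) + u \<bullet> (R *v u) + (A *v x + B *v u) \<bullet> (Y *v (A *v x + B *v u))"
    using riccati_attained[OF Y] .
  show ?thesis
    using riccati_le[OF X, of x u] le[of "A *v x + B *v u"] u by linarith
qed

lemma riccati_eq_iff: "riccati_eq A B Q R X \<longleftrightarrow> riccati X = X"
proof -
  have "transpose A ** schur X ** A = transpose A ** X ** A
      - transpose A ** X ** B ** matrix_inv (gram X) ** transpose B ** X ** A"
    by (simp add: schur_def matrix_eq matrix_vector_mult_diff_rdistrib matrix_mul_assoc
        matrix_vector_mul_assoc[symmetric] matrix_vector_mult_diff_distrib)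
  then have "riccati X = Q + transpose A ** X ** A
      - transpose A ** X ** B ** matrix_inv (gram X) ** transpose B ** X ** A"
    by (simp add: riccati_def)
  then show ?thesis
    unfolding riccati_eq_def gram_def by metis
qed

end

section \<open>Limits of matrices and of Riccati iterates\<close>

lemma tendsto_matrix_mult [tendsto_intros]:
  fixes f :: "'a \<Rightarrow> real^'n^'m" and g :: "'a \<Rightarrow> real^'k^'n"
  assumes "(f \<longlongrightarrow> M) F" "(g \<longlongrightarrow> N) F"
  shows "((\<lambda>x. f x ** g x) \<longlongrightarrow> M ** N) F"
  unfolding matrix_matrix_mult_def by (intro tendsto_intros assms)

lemma tendsto_matrix_vector_mult [tendsto_intros]:
  fixes f :: "'a \<Rightarrow> real^'n^'m"
  assumes "(f \<longlongrightarrow> M) F"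
  shows "((\<lambda>x. f x *v v) \<longlongrightarrow> M *v v) F"
  unfolding matrix_vector_mult_def by (intro tendsto_intros assms)

lemma tendsto_transpose [tendsto_intros]:
  fixes f :: "'a \<Rightarrow> real^'n^'m"
  assumes "(f \<longlongrightarrow> M) F"
  shows "((\<lambda>x. transpose (f x)) \<longlongrightarrow> transpose M) F"
  unfolding transpose_def by (intro tendsto_intros assms)

lemma tendsto_trace [tendsto_intros]:
  fixes f :: "'a \<Rightarrow> real^'n^'n"
  assumes "(f \<longlongrightarrow> M) F"
  shows "((\<lambda>x. trace (f x)) \<longlongrightarrow> trace M) F"
  unfolding trace_def by (intro tendsto_intros assms)

lemma tendsto_det:
  fixes f :: "'a \<Rightarrow> real^'n^'n"
  assumes "\<And>i j. ((\<lambda>x. f x $ i $ j) \<longlongrightarrow> M $ i $ j) F"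
  shows "((\<lambda>x. det (f x)) \<longlongrightarrow> det M) F"
  unfolding det_def by (intro tendsto_intros assms)

text \<open>
  Cramer's rule, as a formula from which continuity of the inverse can be read off.
\<close>

lemma matrix_inv_entry:
  fixes M :: "real^'n^'n"
  assumes "M ** matrix_inv M = mat 1"
  shows "matrix_inv M $ i $ j =
    det (\<chi> a c. if c = i then axis j 1 $ a else M $ a $ c) / det M"
proof -
  have "det M * det (matrix_inv M) = 1"
    using assms by (metis det_I det_mul)
  then have "det M \<noteq> 0"
    by auto
  moreover have "M *v (matrix_inv M *v axis j 1) = axis j 1"
    by (simp add: matrix_vector_mul_assoc assms)
  ultimately have "matrix_inv M *v axis j 1
      = (\<chi> k. det (\<chi> a c. if c = k then axis j 1 $ a else M $ a $ c) / det M)"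
    by (subst (asm) cramer)
  moreover have "(matrix_inv M *v axis j 1) $ i = matrix_inv M $ i $ j"
    by (simp add: matrix_vector_mul_component inner_axis)
  ultimately show ?thesis
    by simp
qed

lemma tendsto_matrix_inv:
  fixes f :: "'a \<Rightarrow> real^'n^'n"
  assumes "(f \<longlongrightarrow> M) F" and inv: "\<And>x. f x ** matrix_inv (f x) = mat 1"
    and invM: "M ** matrix_inv M = mat 1"
  shows "((\<lambda>x. matrix_inv (f x)) \<longlongrightarrow> matrix_inv M) F"
proof (intro vec_tendstoI)
  fix i j
  have "det M * det (matrix_inv M) = 1"
    using invM by (metis det_I det_mul)
  then have "det M \<noteq> 0"
    by auto
  have entry: "((\<lambda>x. (\<chi> a c. if c = i then axis j 1 $ a else f x $ a $ c) $ a $ c)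
      \<longlongrightarrow> (\<chi> a c. if c = i then axis j 1 $ a else M $ a $ c) $ a $ c) F" for a c
    using assms(1) by (cases "c = i") (auto intro!: tendsto_intros)
  have "((\<lambda>x. det (\<chi> a c. if c = i then axis j 1 $ a else f x $ a $ c))
      \<longlongrightarrow> det (\<chi> a c. if c = i then axis j 1 $ a else M $ a $ c)) F"
    by (rule tendsto_det) (rule entry)
  moreover have "((\<lambda>x. det (f x)) \<longlongrightarrow> det M) F"
    by (intro tendsto_det tendsto_vec_nth assms(1))
  ultimately show "((\<lambda>x. matrix_inv (f x) $ i $ j) \<longlongrightarrow> matrix_inv M $ i $ j) F"
    unfolding matrix_inv_entry[OF inv] matrix_inv_entry[OF invM]
    using \<open>det M \<noteq> 0\<close> by (rule tendsto_divide)
qed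

lemma symmetric_matrix_entry:
  fixes M :: "real^'n^'n"
  assumes "transpose M = M"
  shows "M $ i $ j = ((axis i 1 + axis j 1) \<bullet> (M *v (axis i 1 + axis j 1))
    - axis i 1 \<bullet> (M *v axis i 1) - axis j 1 \<bullet> (M *v axis j 1)) / 2"
proof -
  have "axis i 1 \<bullet> (M *v axis j 1) = M $ i $ j" for i j
    by (simp add: inner_axis' matrix_vector_mul_component inner_axis)
  moreover have "M $ j $ i = M $ i $ j"
    using assms by (simp add: transpose_def vec_eq_iff)
  ultimately show ?thesis
    by (simp add: matrix_vector_right_distrib inner_add_left inner_add_right)
qed

text \<open>
  By polarization the entries of a symmetric matrix are combinations of values of its quadratic
  form. This reduces convergence of Riccati iterates to monotone convergence of real sequences.
\<close>

lemma convergent_forms_imp_tendsto: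
  fixes X :: "nat \<Rightarrow> real^'n^'n"
  assumes sym: "\<And>k. transpose (X k) = X k"
    and conv: "\<And>x. convergent (\<lambda>k. x \<bullet> (X k *v x))"
  obtains L where "X \<longlonglongrightarrow> L"
proof -
  define q where "q x = lim (\<lambda>k. x \<bullet> (X k *v x))" for x
  have q: "(\<lambda>k. x \<bullet> (X k *v x)) \<longlonglongrightarrow> q x" for x
    using conv unfolding q_def by (simp add: convergent_LIMSEQ_iff)
  define L :: "real^'n^'n" where
    "L = (\<chi> i j. (q (axis i 1 + axis j 1) - q (axis i 1) - q (axis j 1)) / 2)"
  have "X \<longlonglongrightarrow> L"
    unfolding L_def
    by (intro vec_tendstoI, subst symmetric_matrix_entry[OF sym]) (auto intro!: tendsto_intros q)
  then show thesis
    by (rule that)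
qed

lemma tendsto_psd:
  fixes X :: "nat \<Rightarrow> real^'n^'n"
  assumes "X \<longlonglongrightarrow> L" "\<And>k. sym_psd (X k)"
  shows "sym_psd L"
  unfolding sym_psd_def
proof (intro conjI allI)
  have "(\<lambda>k. transpose (X k)) \<longlonglongrightarrow> transpose L"
    by (intro tendsto_intros assms)
  then show "transpose L = L"
    using assms by (simp add: sym_psd_def LIMSEQ_unique)
  show "0 \<le> x \<bullet> (L *v x)" for x
  proof (rule LIMSEQ_le_const)
    show "(\<lambda>k. x \<bullet> (X k *v x)) \<longlonglongrightarrow> x \<bullet> (L *v x)"
      by (intro tendsto_intros assms)
  qed (use assms(2) in \<open>auto simp: sym_psd_def\<close>)
qed

lemma zero_psd: "sym_psd (0 :: real^'n^'n)"
  by (rule sym_psdI) simp_all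

lemma mat_pow_Suc_right: "mat_pow M (Suc k) = mat_pow M k ** M"
  by (induction k) (simp_all add: matrix_mul_assoc)

lemma matrix_form_bound:
  fixes M :: "real^'n^'n"
  obtains c where "c \<ge> 0" "\<And>x. x \<bullet> (M *v x) \<le> c * (norm x)\<^sup>2"
proof
  show "0 \<le> onorm ((*v) M)"
    by (simp add: onorm_pos_le)
  fix x
  have "x \<bullet> (M *v x) \<le> norm x * norm (M *v x)"
    by (rule norm_cauchy_schwarz)
  also have "\<dots> \<le> norm x * (onorm ((*v) M) * norm x)"
    by (intro mult_left_mono onorm) auto
  finally show "x \<bullet> (M *v x) \<le> onorm ((*v) M) * (norm x)\<^sup>2"
    by (simp add: power2_eq_square mult_ac)
qed

text \<open>
  The solution is the sum of the matrices (F^k)' N F^k; its form at x is the cost, measured by N, of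
  the uncontrolled trajectory of F from x.
\<close>

lemma stein_solution:
  fixes F N :: "real^'n^'n"
  assumes F: "spectral_radius F < 1" and N: "sym_psd N"
  obtains Z where "sym_psd Z" "\<And>x. x \<bullet> (Z *v x) = x \<bullet> (N *v x) + (F *v x) \<bullet> (Z *v (F *v x))"
proof -
  define f where "f x k = (mat_pow F k *v x) \<bullet> (N *v (mat_pow F k *v x))" for x k
  have f_nonneg: "0 \<le> f x k" for x k
    using N by (simp add: f_def sym_psd_def)
  have f_summable: "summable (f x)" for x
  proof -
    obtain c where c: "c \<ge> 0" "\<And>x. x \<bullet> (N *v x) \<le> c * (norm x)\<^sup>2"
      using matrix_form_bound[of N] by blast
    have s: "summable (\<lambda>k. norm (mat_pow F k *v x))"
      by (rule summable_norm_mat_pow[OF F])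
    have "eventually (\<lambda>k. norm (mat_pow F k *v x) < 1) sequentially"
      using order_tendstoD(2)[OF summable_LIMSEQ_zero[OF s]] by simp
    then have "eventually (\<lambda>k. norm (f x k) \<le> c * norm (mat_pow F k *v x)) sequentially"
    proof eventually_elim
      case (elim k)
      \<comment> \<open>Norms below 1 decrease under squaring, so summability of the norms is enough.\<close>
      have "(norm (mat_pow F k *v x))\<^sup>2 \<le> norm (mat_pow F k *v x)"
        using elim by (simp add: power2_eq_square mult_left_le)
      then have "c * (norm (mat_pow F k *v x))\<^sup>2 \<le> c * norm (mat_pow F k *v x)"
        using c(1) by (rule mult_left_mono)
      then show ?case
        using c(2)[of "mat_pow F k *v x"] f_nonneg[of x k] by (simp add: f_def)
    qed
    then show ?thesis
      by (rule summable_comparison_test_ev) (intro summable_mult s)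
  qed
  define X where "X k = (\<Sum>l<k. transpose (mat_pow F l) ** N ** mat_pow F l)" for k
  have X_psd: "sym_psd (X k)" for k
    unfolding X_def by (induction k) (simp_all add: zero_psd sym_psd_add sym_psd_congruence N)
  have X_form: "x \<bullet> (X k *v x) = (\<Sum>l<k. f x l)" for x k
    unfolding X_def
    by (induction k) (simp_all add: matrix_vector_mult_add_rdistrib inner_add_right f_def
        matrix_vector_mul_assoc[symmetric] inner_matrix_left)
  have "convergent (\<lambda>k. x \<bullet> (X k *v x))" for x
    using f_summable by (simp add: X_form summable_iff_convergent)
  then obtain Z where Z: "X \<longlonglongrightarrow> Z"
    using convergent_forms_imp_tendsto[of X] X_psd unfolding sym_psd_def by metis
  have Z_form: "x \<bullet> (Z *v x) = suminf (f x)" for x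
  proof (rule LIMSEQ_unique)
    show "(\<lambda>k. x \<bullet> (X k *v x)) \<longlonglongrightarrow> x \<bullet> (Z *v x)"
      by (intro tendsto_intros Z)
    show "(\<lambda>k. x \<bullet> (X k *v x)) \<longlonglongrightarrow> suminf (f x)"
      unfolding X_form by (rule summable_LIMSEQ[OF f_summable])
  qed
  have "x \<bullet> (Z *v x) = x \<bullet> (N *v x) + (F *v x) \<bullet> (Z *v (F *v x))" for x
  proof -
    have "f x (Suc k) = f (F *v x) k" for k
      unfolding f_def mat_pow_Suc_right by (simp add: matrix_vector_mul_assoc[symmetric])
    then show ?thesis
      using suminf_split_head[OF f_summable, of x] by (simp add: Z_form) (simp add: f_def)
  qed
  then show thesis
    using that tendsto_psd[OF Z X_psd] by blast
qed

context lqr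
begin

lemma tendsto_inv_gram:
  assumes "X \<longlonglongrightarrow> L" "\<And>k. sym_psd (X k)"
  shows "(\<lambda>k. matrix_inv (gram (X k))) \<longlonglongrightarrow> matrix_inv (gram L)"
proof (rule tendsto_matrix_inv)
  show "(\<lambda>k. gram (X k)) \<longlonglongrightarrow> gram L"
    unfolding gram_def by (intro tendsto_intros assms)
qed (use assms tendsto_psd in \<open>blast intro: sym_pd_matrix_inv(1) gram_pd\<close>)+

lemma
  assumes "X \<longlonglongrightarrow> L" "\<And>k. sym_psd (X k)"
  shows tendsto_schur: "(\<lambda>k. schur (X k)) \<longlonglongrightarrow> schur L"
    and tendsto_ctrl: "(\<lambda>k. ctrl (X k)) \<longlonglongrightarrow> ctrl L"
    and tendsto_closed_loop: "(\<lambda>k. closed_loop (X k)) \<longlonglongrightarrow> closed_loop L"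
    and tendsto_riccati: "(\<lambda>k. riccati (X k)) \<longlonglongrightarrow> riccati L"
  unfolding schur_def ctrl_def closed_loop_def gain_def riccati_def
  by (intro tendsto_intros tendsto_inv_gram assms)+

lemma riccati_iter_psd: "sym_psd X \<Longrightarrow> sym_psd ((riccati ^^ k) X)"
  by (induction k) (simp_all add: riccati_psd)

lemma riccati_iter_mono:
  assumes "sym_psd X" "sym_psd Y" "\<And>x. x \<bullet> (X *v x) \<le> x \<bullet> (Y *v x)"
  shows "x \<bullet> ((riccati ^^ k) X *v x) \<le> x \<bullet> ((riccati ^^ k) Y *v x)"
  using assms(3)
  by (induction k arbitrary: x) (simp_all add: riccati_mono riccati_iter_psd assms(1,2))

lemma riccati_iter_limit:
  assumes "sym_psd X" "\<And>x. convergent (\<lambda>k. x \<bullet> ((riccati ^^ k) X *v x))"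
  obtains L where "sym_psd L" "riccati L = L" "(\<lambda>k. (riccati ^^ k) X) \<longlonglongrightarrow> L"
proof -
  obtain L where L: "(\<lambda>k. (riccati ^^ k) X) \<longlonglongrightarrow> L"
    using convergent_forms_imp_tendsto[of "\<lambda>k. (riccati ^^ k) X"] assms
      riccati_iter_psd[OF assms(1)] unfolding sym_psd_def by metis
  have "(\<lambda>k. riccati ((riccati ^^ k) X)) \<longlonglongrightarrow> riccati L"
    by (rule tendsto_riccati[OF L riccati_iter_psd[OF assms(1)]])
  moreover have "(\<lambda>k. riccati ((riccati ^^ k) X)) \<longlonglongrightarrow> L"
    using LIMSEQ_Suc[OF L] by simp
  ultimately have "riccati L = L"
    by (rule LIMSEQ_unique)
  then show thesis
    using that L tendsto_psd[OF L riccati_iter_psd[OF assms(1)]] by blast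
qed

end

text \<open>
  Uniqueness of P is what identifies the limits of increasing and of decreasing Riccati iterates
  with each other. Without it they can differ: for A = 2, B = R = 1 and Q = 0 the iterates from 0
  stay at 0, while those from large terminal costs tend to 3.
\<close>

locale lqr_stabilizable = lqr A B Q R
  for A :: "real^'n^'n" and B :: "real^'m^'n" and Q :: "real^'n^'n" and R :: "real^'m^'m" +
  fixes P :: "real^'n^'n"
  assumes stab: "stabilizable A B"
    and P_psd: "sym_psd P" and P_riccati: "riccati P = P"
    and P_unique: "\<And>X. sym_psd X \<Longrightarrow> riccati X = X \<Longrightarrow> X = P"
begin

lemma P_iter: "(riccati ^^ k) P = P"
  by (induction k) (simp_all add: P_riccati)

lemma riccati_iter_zero_le: "x \<bullet> ((riccati ^^ k) 0 *v x) \<le> x \<bullet> (P *v x)"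
  using riccati_iter_mono[OF zero_psd P_psd, of x k] P_psd by (simp add: P_iter sym_psd_def)

text \<open>
  A longer horizon can only cost more when the terminal cost is 0, and every such cost stays below
  that of the fixed point P.
\<close>

lemma riccati_iter_zero_tendsto: "(\<lambda>k. (riccati ^^ k) 0) \<longlonglongrightarrow> P"
proof -
  have "x \<bullet> ((riccati ^^ k) 0 *v x) \<le> x \<bullet> ((riccati ^^ Suc k) 0 *v x)" for k x
    using riccati_iter_mono[OF zero_psd riccati_psd[OF zero_psd], of x k]
      riccati_psd[OF zero_psd] by (simp add: sym_psd_def funpow_swap1)
  then have "incseq (\<lambda>k. x \<bullet> ((riccati ^^ k) 0 *v x))" for x
    by (rule incseq_SucI)
  then have "convergent (\<lambda>k. x \<bullet> ((riccati ^^ k) 0 *v x))" for x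
    using incseq_convergent[of _ "x \<bullet> (P *v x)"] riccati_iter_zero_le
    unfolding convergent_def by metis
  then show ?thesis
    using riccati_iter_limit[OF zero_psd] P_unique by metis
qed

text \<open>
  For a stabilizing gain L, the matrix Z is the cost of using u = - L x for ever, with Qf added to
  the stage cost to make Z dominate Qf. Optimizing the first step of this policy cannot raise its
  cost, so riccati Z lies below Z and the iterates decrease.
\<close>

lemma dominating_terminal_cost:
  assumes "sym_psd Qf"
  obtains Z where "sym_psd Z" "\<And>x. x \<bullet> (Qf *v x) \<le> x \<bullet> (Z *v x)"
    "(\<lambda>k. (riccati ^^ k) Z) \<longlonglongrightarrow> P"
proof -
  obtain L where L: "spectral_radius (A - B ** L) < 1"
    using stab unfolding stabilizable_def by blast
  let ?N = "Q + transpose L ** R ** L + Qf"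
  have N: "sym_psd ?N"
    by (intro sym_psd_add sym_psd_congruence Q_psd sym_pd_imp_psd R_pd assms)
  have N_form: "x \<bullet> (?N *v x) = x \<bullet> (Q *v x) + (L *v x) \<bullet> (R *v (L *v x)) + x \<bullet> (Qf *v x)" for x
    by (simp add: matrix_vector_mult_add_rdistrib inner_add_right
        matrix_vector_mul_assoc[symmetric] inner_matrix_left)
  obtain Z where Z: "sym_psd Z" and Z_form: "\<And>x. x \<bullet> (Z *v x)
      = x \<bullet> (?N *v x) + ((A - B ** L) *v x) \<bullet> (Z *v ((A - B ** L) *v x))"
    using stein_solution[OF L N] by blast
  have nonneg: "0 \<le> x \<bullet> (Z *v x)" "0 \<le> x \<bullet> (Q *v x)" "0 \<le> x \<bullet> (Qf *v x)"
    "0 \<le> u \<bullet> (R *v u)" for x u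
    using Z Q_psd assms sym_pd_imp_psd[OF R_pd] by (auto simp: sym_psd_def)
  have ge: "x \<bullet> (Qf *v x) \<le> x \<bullet> (Z *v x)" for x
    using Z_form[of x] N_form[of x] nonneg(1)[of "(A - B ** L) *v x"] nonneg(2)[of x]
      nonneg(4)[of "L *v x"] by linarith
  have super: "x \<bullet> (riccati Z *v x) \<le> x \<bullet> (Z *v x)" for x
  proof -
    have "A *v x + B *v (- (L *v x)) = (A - B ** L) *v x"
      by (simp add: matrix_vector_mul_minus matrix_vector_mult_diff_rdistrib
          matrix_vector_mul_assoc[symmetric])
    then show ?thesis
      using riccati_le[OF Z, of x "- (L *v x)"] Z_form[of x] N_form[of x] nonneg(3)[of x]
      by (simp add: matrix_vector_mul_minus)
  qed
  have "x \<bullet> ((riccati ^^ Suc k) Z *v x) \<le> x \<bullet> ((riccati ^^ k) Z *v x)" for x k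
    using riccati_iter_mono[OF riccati_psd[OF Z] Z super, of x k] by (simp add: funpow_swap1)
  then have "decseq (\<lambda>k. x \<bullet> ((riccati ^^ k) Z *v x))" for x
    by (rule decseq_SucI)
  moreover have "0 \<le> x \<bullet> ((riccati ^^ k) Z *v x)" for x k
    using riccati_iter_psd[OF Z] by (simp add: sym_psd_def)
  ultimately have "convergent (\<lambda>k. x \<bullet> ((riccati ^^ k) Z *v x))" for x
    using decseq_convergent[of _ 0] unfolding convergent_def by metis
  then have "(\<lambda>k. (riccati ^^ k) Z) \<longlonglongrightarrow> P"
    using riccati_iter_limit[OF Z] P_unique by metis
  then show thesis
    using that Z ge by blast
qed

end

section \<open>Kernel and range of a semidefinite form\<close>

text \<open>
  The form at z + t M z is 2 t |M z|^2 + O(t^2), negative for small negative t unless M z = 0.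
\<close>

lemma psd_form_eq_0_imp:
  assumes M: "sym_psd M" and z: "z \<bullet> (M *v z) = 0"
  shows "M *v z = 0"
proof (rule ccontr)
  define y where "y = M *v z"
  define a where "a = y \<bullet> y"
  define q where "q = y \<bullet> (M *v y)"
  \<comment> \<open>Close to the minimizer - a / q of the form on the line, and defined when q = 0 too.\<close>
  define t where "t = - a / (q + 1)"
  assume "M *v z \<noteq> 0"
  then have a: "a > 0"
    by (simp add: a_def y_def)
  have q: "q \<ge> 0"
    using M by (simp add: q_def sym_psd_def)
  have "z \<bullet> (M *v y) = a"
    using sym_psd_inner[OF M, of z y] by (simp add: a_def y_def)
  then have "(z + t *\<^sub>R y) \<bullet> (M *v (z + t *\<^sub>R y)) = 2 * t * a + t\<^sup>2 * q"
    using z by (simp add: matrix_vector_right_distrib matrix_vector_mul_scaleR inner_add_left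
        inner_add_right y_def[symmetric] a_def[symmetric] q_def[symmetric] power2_eq_square algebra_simps)
  then have "0 \<le> 2 * t * a + t\<^sup>2 * q"
    using M by (metis sym_psd_def)
  also have "2 * t * a + t\<^sup>2 * q = - (t\<^sup>2 * (q + 2))"
  proof -
    have "a = - (t * (q + 1))"
      using q by (simp add: t_def)
    then have "2 * t * a = 2 * t * - (t * (q + 1))"
      by (rule arg_cong)
    then show ?thesis
      by (simp add: algebra_simps power2_eq_square)
  qed
  also have "\<dots> < 0"
    using a q by (simp add: t_def)
  finally show False
    by simp
qed

lemma psd_form_diff_le:
  assumes "sym_psd M"
  shows "(x - y) \<bullet> (M *v (x - y)) \<le> 2 * (x \<bullet> (M *v x)) + 2 * (y \<bullet> (M *v y))"
proof -
  have "0 \<le> (x + y) \<bullet> (M *v (x + y))"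
    using assms by (simp add: sym_psd_def)
  then show ?thesis
    by (simp add: matrix_vector_right_distrib matrix_vector_mult_diff_distrib inner_add_left
        inner_add_right inner_diff_left inner_diff_right)
qed

lemma matrix_form_diff_tendsto:
  fixes X :: "nat \<Rightarrow> real^'n^'n"
  assumes "X \<longlonglongrightarrow> L" "e > 0"
  obtains k where "\<And>x. x \<bullet> (L *v x) - x \<bullet> (X k *v x) \<le> e * (norm x)\<^sup>2"
proof -
  have "(\<lambda>k. \<Sum>i\<in>UNIV. \<Sum>j\<in>UNIV. \<bar>(L - X k) $ i $ j\<bar>) \<longlonglongrightarrow> (\<Sum>i\<in>UNIV. \<Sum>j\<in>UNIV. \<bar>(L - L) $ i $ j\<bar>)"
    by (intro tendsto_intros assms(1))
  then have "eventually (\<lambda>k. (\<Sum>i\<in>UNIV. \<Sum>j\<in>UNIV. \<bar>(L - X k) $ i $ j\<bar>) < e) sequentially"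
    using assms(2) by (intro order_tendstoD(2)) auto
  then obtain k where k: "(\<Sum>i\<in>UNIV. \<Sum>j\<in>UNIV. \<bar>(L - X k) $ i $ j\<bar>) < e"
    by (auto simp: eventually_sequentially)
  have "x \<bullet> (L *v x) - x \<bullet> (X k *v x) \<le> e * (norm x)\<^sup>2" for x
  proof -
    have "x \<bullet> (L *v x) - x \<bullet> (X k *v x) = x \<bullet> ((L - X k) *v x)"
      by (simp add: matrix_vector_mult_diff_rdistrib inner_diff_right)
    also have "\<dots> \<le> norm x * norm ((L - X k) *v x)"
      by (rule norm_cauchy_schwarz)
    also have "\<dots> \<le> norm x * (onorm ((*v) (L - X k)) * norm x)"
      by (intro mult_left_mono onorm) auto
    also have "\<dots> \<le> norm x * (e * norm x)"
      using onorm_le_matrix_component_sum[of "L - X k"] k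
      by (intro mult_left_mono mult_right_mono) auto
    finally show ?thesis
      by (simp add: power2_eq_square mult_ac)
  qed
  then show thesis
    by (rule that)
qed

text \<open>
  On the range of P, which is orthogonal to its kernel, the form of P is positive away from 0, hence
  bounded below on the compact unit sphere there.
\<close>

lemma psd_coercive_on_range:
  fixes P :: "real^'n^'n"
  assumes P: "sym_psd P"
  obtains c where "c > 0" "\<And>x. c * (norm (P *v x))\<^sup>2 \<le> (P *v x) \<bullet> (P *v (P *v x))"
proof -
  let ?V = "range ((*v) P)"
  let ?S = "sphere 0 1 \<inter> ?V"
  have "subspace ?V"
    by (intro linear_subspace_image) auto
  then have S: "compact ?S"
    by (intro compact_Int_closed closed_subspace) auto
  have pos: "0 < x \<bullet> (P *v x)" if x: "x \<in> ?S" for x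
  proof -
    obtain y where y: "x = P *v y"
      using x by blast
    have "x \<bullet> (P *v x) \<noteq> 0"
    proof
      assume "x \<bullet> (P *v x) = 0"
      then have "P *v x = 0"
        using psd_form_eq_0_imp[OF P] by simp
      then have "x \<bullet> x = 0"
        using sym_psd_inner[OF P, of y x] y by simp
      with x show False
        by simp
    qed
    moreover have "0 \<le> x \<bullet> (P *v x)"
      using P by (simp add: sym_psd_def)
    ultimately show ?thesis
      by simp
  qed
  obtain c where c: "c > 0" "\<And>x. x \<in> ?S \<Longrightarrow> c \<le> x \<bullet> (P *v x)"
  proof (cases "?S = {}")
    case True
    then show thesis
      using that[of 1] by auto
  next
    case False
    have "continuous_on ?S (\<lambda>x. x \<bullet> (P *v x))"
      by (intro continuous_intros)
    then obtain x where "x \<in> ?S" "\<And>y. y \<in> ?S \<Longrightarrow> x \<bullet> (P *v x) \<le> y \<bullet> (P *v y)"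
      using continuous_attains_inf[OF S False] by blast
    then show thesis
      using that pos by blast
  qed
  have "c * (norm (P *v x))\<^sup>2 \<le> (P *v x) \<bullet> (P *v (P *v x))" for x
  proof (cases "P *v x = 0")
    case False
    define r where "r = inverse (norm (P *v x))"
    have "norm (r *\<^sub>R (P *v x)) = 1"
      using False by (simp add: r_def)
    moreover have "r *\<^sub>R (P *v x) = P *v (r *\<^sub>R x)"
      by (simp add: matrix_vector_mul_scaleR)
    ultimately have "r *\<^sub>R (P *v x) \<in> ?S"
      by (simp add: image_iff) metis
    then have "c \<le> (r *\<^sub>R (P *v x)) \<bullet> (P *v (r *\<^sub>R (P *v x)))"
      by (rule c(2))
    then have "c \<le> r\<^sup>2 * ((P *v x) \<bullet> (P *v (P *v x)))"
      by (simp add: matrix_vector_mul_scaleR power2_eq_square)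
    then show ?thesis
      using False by (simp add: r_def field_simps power2_eq_square)
  qed simp
  with c(1) show thesis
    by (rule that)
qed

section \<open>The horizon cost along an arbitrary trajectory\<close>

context lqr
begin

text \<open>
  The linear part of the value function with k steps to go. Both k and the noise sequence run
  backwards in time: the argument k of the noise is the vector acting with k steps left after it.
\<close>

primrec costate :: "real^'n^'n \<Rightarrow> (nat \<Rightarrow> real^'n) \<Rightarrow> nat \<Rightarrow> real^'n" where
  "costate X \<omega> 0 = 0"
| "costate X \<omega> (Suc k) = costate_step ((riccati ^^ k) X) (costate X \<omega> k) (\<omega> k)"

definition optimal_cost :: "real^'n^'n \<Rightarrow> (nat \<Rightarrow> real^'n) \<Rightarrow> nat \<Rightarrow> real" where
  "optimal_cost X \<omega> T = (\<Sum>k<T. offset ((riccati ^^ k) X) (costate X \<omega> k) (\<omega> k))"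

text \<open>
  Noise of horizon T indexed by the number of remaining steps. The last vector that acts is
  w (T - 1), with no step left after it.
\<close>

definition reversed :: "nat \<Rightarrow> (nat \<Rightarrow> real^'n) \<Rightarrow> nat \<Rightarrow> real^'n" where
  "reversed T w k = w (T - Suc k)"

definition optimal_control ::
  "real^'n^'n \<Rightarrow> nat \<Rightarrow> (nat \<Rightarrow> real^'n) \<Rightarrow> real^'n \<Rightarrow> nat \<Rightarrow> real^'m" where
  "optimal_control X T w x t =
     policy ((riccati ^^ (T - Suc t)) X) (costate X (reversed T w) (T - Suc t)) (A *v x + w t)"

abbreviation deviation ::
  "real^'n^'n \<Rightarrow> nat \<Rightarrow> (nat \<Rightarrow> real^'n) \<Rightarrow> (nat \<Rightarrow> real^'m) \<Rightarrow> nat \<Rightarrow> real^'m" where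
  "deviation X T w u t \<equiv> u t - optimal_control X T w (lin_state A B w u t) t"

text \<open>
  The value function, evaluated along an arbitrary trajectory and added to the cost already paid,
  grows in each step by exactly the square in the Bellman identity. At time 0 the state is 0, so only
  the constant part of the value function is left; at time T only the terminal form is left.
\<close>

lemma horizon_cost_eq:
  assumes X: "sym_psd X"
  shows "horizon_cost A B Q R X T w u = optimal_cost X (reversed T w) T
    + (\<Sum>t<T. deviation X T w u t \<bullet> (gram ((riccati ^^ (T - Suc t)) X) *v deviation X T w u t))"
proof -
  let ?x = "lin_state A B w u" and ?\<omega> = "reversed T w"
  let ?sq = "\<lambda>t. deviation X T w u t \<bullet> (gram ((riccati ^^ (T - Suc t)) X) *v deviation X T w u t)"
  have "running_cost A B Q R s w u + ?x s \<bullet> ((riccati ^^ (T - s)) X *v ?x s)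
      + 2 * (costate X ?\<omega> (T - s) \<bullet> ?x s) + optimal_cost X ?\<omega> (T - s)
      = optimal_cost X ?\<omega> T + (\<Sum>t<s. ?sq t)" if "s \<le> T" for s
    using that
  proof (induction s)
    case 0
    then show ?case
      by (simp add: running_cost_def)
  next
    case (Suc s)
    define k where "k = T - Suc s"
    have k: "T - s = Suc k" "?\<omega> k = w s" "T - Suc s = k"
      using Suc.prems by (auto simp: k_def reversed_def)
    have "?x (Suc s) = A *v ?x s + B *v u s + w s"
      by simp
    from bellman_identity[OF riccati_iter_psd[OF X] this, of k "costate X ?\<omega> k"]
    have "?x s \<bullet> (Q *v ?x s) + u s \<bullet> (R *v u s) + ?x (Suc s) \<bullet> ((riccati ^^ k) X *v ?x (Suc s))
        + 2 * (costate X ?\<omega> k \<bullet> ?x (Suc s))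
      = ?x s \<bullet> ((riccati ^^ Suc k) X *v ?x s) + 2 * (costate X ?\<omega> (Suc k) \<bullet> ?x s)
        + offset ((riccati ^^ k) X) (costate X ?\<omega> k) (?\<omega> k) + ?sq s"
      by (simp add: optimal_control_def k)
    moreover have "running_cost A B Q R (Suc s) w u
        = running_cost A B Q R s w u + (?x s \<bullet> (Q *v ?x s) + u s \<bullet> (R *v u s))"
      by (simp add: running_cost_def)
    moreover have "optimal_cost X ?\<omega> (Suc k)
        = optimal_cost X ?\<omega> k + offset ((riccati ^^ k) X) (costate X ?\<omega> k) (?\<omega> k)"
      by (simp add: optimal_cost_def)
    moreover note Suc.IH
    ultimately show ?case
      using Suc.prems by (simp add: k del: lin_state.simps funpow.simps costate.simps)
  qed
  from this[of T] show ?thesis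
    by (simp add: horizon_cost_def optimal_cost_def)
qed

lemma deviation_form_nonneg:
  "sym_psd X \<Longrightarrow> 0 \<le> d \<bullet> (gram ((riccati ^^ k) X) *v d)"
  by (intro gram_form_nonneg riccati_iter_psd)

lemma optimal_cost_le_horizon_cost:
  "sym_psd X \<Longrightarrow> optimal_cost X (reversed T w) T \<le> horizon_cost A B Q R X T w u"
  by (simp add: horizon_cost_eq deviation_form_nonneg sum_nonneg)

lemma optimal_cost_attained:
  assumes "sym_psd X"
  obtains u where "horizon_cost A B Q R X T w u = optimal_cost X (reversed T w) T"
proof -
  define x where "x = rec_nat 0 (\<lambda>t y. A *v y + B *v optimal_control X T w y t + w t)"
  define u where "u t = optimal_control X T w (x t) t" for t
  have "lin_state A B w u t = x t" for t
    by (induction t) (simp_all add: x_def u_def)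
  then have "deviation X T w u t = 0" for t
    by (simp add: u_def)
  then have "horizon_cost A B Q R X T w u = optimal_cost X (reversed T w) T"
    using horizon_cost_eq[OF assms, of T w u] by simp
  then show thesis
    by (rule that)
qed

lemma offline_optimal_cost:
  assumes X: "sym_psd X" and u: "offline_optimal A B Q R X T w u"
  shows "horizon_cost A B Q R X T w u = optimal_cost X (reversed T w) T"
proof (rule antisym)
  obtain u' where "horizon_cost A B Q R X T w u' = optimal_cost X (reversed T w) T"
    using optimal_cost_attained[OF X] by blast
  then show "horizon_cost A B Q R X T w u \<le> optimal_cost X (reversed T w) T"
    using u by (metis is_arg_min_linorder offline_optimal_def)
qed (rule optimal_cost_le_horizon_cost[OF X])

text \<open>
  Positive definiteness of the gram matrices turns optimality into a feedback law, so a minimizer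
  chosen separately for each noise realization is automatically a measurable function of the noise.
\<close>

lemma offline_optimal_control:
  assumes X: "sym_psd X" and u: "offline_optimal A B Q R X T w u" and t: "t < T"
  shows "u t = optimal_control X T w (lin_state A B w u t) t"
proof -
  have "(\<Sum>t<T. deviation X T w u t \<bullet> (gram ((riccati ^^ (T - Suc t)) X) *v deviation X T w u t)) = 0"
    using horizon_cost_eq[OF X, of T w u] offline_optimal_cost[OF X u] by simp
  then have "deviation X T w u t \<bullet> (gram ((riccati ^^ (T - Suc t)) X) *v deviation X T w u t) = 0"
    using t by (subst (asm) sum_nonneg_eq_0_iff) (auto simp: deviation_form_nonneg X)
  then show ?thesis
    by (simp add: gram_form_eq_0 riccati_iter_psd X)
qed

abbreviation stage_cost :: "(nat \<Rightarrow> real^'n) \<Rightarrow> (nat \<Rightarrow> real^'m) \<Rightarrow> nat \<Rightarrow> real" where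
  "stage_cost w u t \<equiv>
     lin_state A B w u t \<bullet> (Q *v lin_state A B w u t) + u t \<bullet> (R *v u t)"

lemma stage_cost_nonneg: "0 \<le> stage_cost w u t"
  using Q_psd sym_pd_imp_psd[OF R_pd] by (simp add: sym_psd_def)

text \<open>
  The left-hand side is the least cost over k steps from the current state without noise, so the
  controls actually applied give a bound. Splitting off the noise of one step costs a factor 2 by
  the inequality psd_form_diff_le and a constant that depends on the noise bound.
\<close>

lemma finite_horizon_form_le:
  "\<exists>C\<ge>0. \<forall>w u s. (\<forall>t. norm (w t) \<le> b) \<longrightarrow>
     lin_state A B w u s \<bullet> ((riccati ^^ k) 0 *v lin_state A B w u s)
       \<le> 2 ^ k * (\<Sum>j<k. stage_cost w u (s + j)) + C"
proof (induction k)
  case 0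
  show ?case
    by (intro exI[of _ 0]) simp
next
  case (Suc k)
  then obtain C where C: "C \<ge> 0" "\<And>w u s. \<forall>t. norm (w t) \<le> b \<Longrightarrow>
      lin_state A B w u s \<bullet> ((riccati ^^ k) 0 *v lin_state A B w u s)
        \<le> 2 ^ k * (\<Sum>j<k. stage_cost w u (s + j)) + C"
    by blast
  let ?X = "(riccati ^^ k) (0 :: real^'n^'n)"
  have X: "sym_psd ?X"
    by (intro riccati_iter_psd zero_psd)
  obtain c where c: "c \<ge> 0" "\<And>x. x \<bullet> (?X *v x) \<le> c * (norm x)\<^sup>2"
    using matrix_form_bound[of ?X] by blast
  show ?case
  proof (intro exI[of _ "2 * C + 2 * (c * b\<^sup>2)"] conjI allI impI)
    show "0 \<le> 2 * C + 2 * (c * b\<^sup>2)"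
      using C(1) c(1) by simp
    fix w :: "nat \<Rightarrow> real^'n" and u s
    assume w: "\<forall>t. norm (w t) \<le> b"
    let ?x = "lin_state A B w u"
    have "w s \<bullet> (?X *v w s) \<le> c * (norm (w s))\<^sup>2"
      by (rule c(2))
    also have "\<dots> \<le> c * b\<^sup>2"
      using w c(1) by (intro mult_left_mono power_mono) auto
    finally have noise: "w s \<bullet> (?X *v w s) \<le> c * b\<^sup>2" .
    have next_state: "A *v ?x s + B *v u s = ?x (Suc s) - w s"
      by simp
    have "?x s \<bullet> ((riccati ^^ Suc k) 0 *v ?x s)
        \<le> stage_cost w u s + (?x (Suc s) - w s) \<bullet> (?X *v (?x (Suc s) - w s))"
      using riccati_le[OF X, of "?x s" "u s"] unfolding next_state by simp
    also have "\<dots> \<le> stage_cost w u s + (2 * (?x (Suc s) \<bullet> (?X *v ?x (Suc s))) + 2 * (c * b\<^sup>2))"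
      using psd_form_diff_le[OF X, of "?x (Suc s)" "w s"] noise by linarith
    also have "\<dots> \<le> stage_cost w u s
        + (2 * (2 ^ k * (\<Sum>j<k. stage_cost w u (Suc s + j)) + C) + 2 * (c * b\<^sup>2))"
      by (intro add_left_mono add_right_mono mult_left_mono C(2) w) simp
    also have "\<dots> \<le> 2 ^ Suc k * stage_cost w u s
        + (2 * (2 ^ k * (\<Sum>j<k. stage_cost w u (Suc s + j)) + C) + 2 * (c * b\<^sup>2))"
    proof -
      have "1 * stage_cost w u s \<le> 2 ^ Suc k * stage_cost w u s"
        by (intro mult_right_mono stage_cost_nonneg) (rule one_le_power, simp)
      then show ?thesis
        by (simp only: mult_1 add_le_cancel_right)
    qed
    also have "\<dots> = 2 ^ Suc k * (\<Sum>j<Suc k. stage_cost w u (s + j)) + (2 * C + 2 * (c * b\<^sup>2))"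
      unfolding sum.lessThan_Suc_shift by (simp add: algebra_simps)
    finally show "?x s \<bullet> ((riccati ^^ Suc k) 0 *v ?x s)
        \<le> 2 ^ Suc k * (\<Sum>j<Suc k. stage_cost w u (s + j)) + (2 * C + 2 * (c * b\<^sup>2))" .
  qed
qed

lemma running_cost_mono: "s \<le> T \<Longrightarrow> running_cost A B Q R s w u \<le> running_cost A B Q R T w u"
  unfolding running_cost_def by (intro sum_mono2) (auto intro: stage_cost_nonneg)

end

section \<open>The stationary cost is controlled by finite horizons\<close>

context lqr_stabilizable
begin

text \<open>
  The iterates from 0 lie below P, so they vanish on the kernel of P. On the orthogonal complement,
  the range of P, the form of P is coercive, and an iterate that approximates P within half of
  the coercivity constant is at least half of P.
\<close>

lemma P_dominated_by_finite_horizon: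
  obtains k where "\<And>x. x \<bullet> (P *v x) \<le> 2 * (x \<bullet> ((riccati ^^ k) 0 *v x))"
proof -
  obtain c where c: "c > 0" "\<And>x. c * (norm (P *v x))\<^sup>2 \<le> (P *v x) \<bullet> (P *v (P *v x))"
    using psd_coercive_on_range[OF P_psd] by blast
  obtain k where k: "\<And>x. x \<bullet> (P *v x) - x \<bullet> ((riccati ^^ k) 0 *v x) \<le> c / 2 * (norm x)\<^sup>2"
    using matrix_form_diff_tendsto[OF riccati_iter_zero_tendsto, of "c / 2"] c(1) by auto
  let ?X = "(riccati ^^ k) (0 :: real^'n^'n)"
  have X: "sym_psd ?X"
    by (intro riccati_iter_psd zero_psd)
  have "x \<bullet> (P *v x) \<le> 2 * (x \<bullet> (?X *v x))" for x
  proof -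
    let ?V = "range ((*v) P)"
    have "subspace ?V"
      by (intro linear_subspace_image) auto
    obtain y z where y: "y \<in> span ?V" and z: "\<And>v. v \<in> span ?V \<Longrightarrow> orthogonal z v" and x: "x = y + z"
      using orthogonal_subspace_decomp_exists[of ?V x] by blast
    have "y \<in> ?V"
      using y \<open>subspace ?V\<close> by (simp add: span_eq_iff[THEN iffD2])
    then obtain y' where y': "y = P *v y'"
      by auto
    have "orthogonal z (P *v (P *v z))"
      by (intro z span_base) auto
    then have "(P *v z) \<bullet> (P *v z) = 0"
      using sym_psd_inner[OF P_psd, of z "P *v z"] by (simp add: orthogonal_def)
    then have Pz: "P *v z = 0"
      by simp
    then have "z \<bullet> (?X *v z) = 0"
      using riccati_iter_zero_le[of z k] X by (simp add: sym_psd_def order_antisym)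
    then have Xz: "?X *v z = 0"
      by (rule psd_form_eq_0_imp[OF X])
    have reduce: "x \<bullet> (M *v x) = y \<bullet> (M *v y)" if "sym_psd M" "M *v z = 0" for M
      using sym_psd_inner[OF that(1), of z y] that(2)
      by (simp add: x matrix_vector_right_distrib inner_add_left)
    have "y \<bullet> (P *v y) \<le> 2 * (y \<bullet> (?X *v y))"
      using k[of y] c(2)[of y'] y' by simp
    then show ?thesis
      by (simp add: reduce[OF P_psd Pz] reduce[OF X Xz])
  qed
  then show thesis
    by (rule that)
qed

text \<open>
  Adding the terminal form x \<bullet> P x to the running cost up to time s gives at least the optimal cost
  of horizon s. That terminal form may be large at any single time, but it is bounded by the stage
  costs of the next k steps; over a window of times s each stage cost is counted at most k times, so
  the total of the terminal forms is a fixed multiple of one running cost, plus a constant for each s.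
\<close>

lemma optimal_cost_window_le:
  "\<exists>k. \<exists>C\<ge>0. \<forall>w u T m. (\<forall>t. norm (w t) \<le> b) \<longrightarrow> m + k \<le> T \<longrightarrow>
     (\<Sum>s\<in>{T-k-m..<T-k}. optimal_cost P (reversed s w) s)
       \<le> (real m + C) * running_cost A B Q R T w u + real m * C"
proof -
  obtain k where k: "\<And>x. x \<bullet> (P *v x) \<le> 2 * (x \<bullet> ((riccati ^^ k) 0 *v x))"
    using P_dominated_by_finite_horizon by blast
  obtain D where D: "D \<ge> 0" "\<And>w u s. \<forall>t. norm (w t) \<le> b \<Longrightarrow>
     lin_state A B w u s \<bullet> ((riccati ^^ k) 0 *v lin_state A B w u s)
       \<le> 2 ^ k * (\<Sum>j<k. stage_cost w u (s + j)) + D"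
    using finite_horizon_form_le[of b k] by blast
  define C where "C = 2 * D + 2 * 2 ^ k * real k"
  have C: "C \<ge> 0" "2 * D \<le> C" "2 * 2 ^ k * real k \<le> C"
    using D(1) by (auto simp: C_def)
  show ?thesis
  proof (intro exI[of _ k] exI[of _ C] conjI C(1) allI impI)
    fix w :: "nat \<Rightarrow> real^'n" and u :: "nat \<Rightarrow> real^'m" and T m
    assume w: "\<forall>t. norm (w t) \<le> b" and T: "m + k \<le> T"
    let ?I = "{T-k-m..<T-k}" and ?x = "lin_state A B w u" and ?r = "running_cost A B Q R T w u"
    have r: "0 \<le> ?r"
      unfolding running_cost_def by (intro sum_nonneg stage_cost_nonneg)
    have I: "card ?I = m"
      using T by simp
    have "optimal_cost P (reversed s w) s
        \<le> ?r + 2 * (2 ^ k * (\<Sum>j<k. stage_cost w u (s + j)) + D)" if "s \<in> ?I" for s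
    proof -
      have "optimal_cost P (reversed s w) s \<le> running_cost A B Q R s w u + ?x s \<bullet> (P *v ?x s)"
        using optimal_cost_le_horizon_cost[OF P_psd] by (simp add: horizon_cost_def)
      also have "running_cost A B Q R s w u \<le> ?r"
        using that by (intro running_cost_mono) auto
      also have "?x s \<bullet> (P *v ?x s) \<le> 2 * (2 ^ k * (\<Sum>j<k. stage_cost w u (s + j)) + D)"
        using k[of "?x s"] D(2)[of w u s] w by force
      finally show ?thesis
        by simp
    qed
    then have "(\<Sum>s\<in>?I. optimal_cost P (reversed s w) s)
        \<le> (\<Sum>s\<in>?I. ?r + 2 * (2 ^ k * (\<Sum>j<k. stage_cost w u (s + j)) + D))"
      by (rule sum_mono)
    also have "\<dots> = real m * ?r + 2 * 2 ^ k * (\<Sum>s\<in>?I. \<Sum>j<k. stage_cost w u (s + j))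
        + real m * (2 * D)"
      using I by (simp add: sum.distrib sum_distrib_left distrib_left mult.assoc)
    also have "(\<Sum>s\<in>?I. \<Sum>j<k. stage_cost w u (s + j)) \<le> (\<Sum>j<k. ?r)"
    proof (subst sum.swap, rule sum_mono)
      fix j assume j: "j \<in> {..<k}"
      have "(\<Sum>s\<in>?I. stage_cost w u (s + j)) = (\<Sum>t\<in>(\<lambda>s. s + j) ` ?I. stage_cost w u t)"
        by (subst sum.reindex) (auto simp: inj_on_def)
      also have "\<dots> \<le> ?r"
        unfolding running_cost_def using j
        by (intro sum_mono2) (auto intro: stage_cost_nonneg)
      finally show "(\<Sum>s\<in>?I. stage_cost w u (s + j)) \<le> ?r" .
    qed
    also have "real m * ?r + 2 * 2 ^ k * (\<Sum>j<k. ?r) + real m * (2 * D)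
        = real m * ?r + (2 * 2 ^ k * real k) * ?r + real m * (2 * D)"
      by simp
    also have "\<dots> \<le> real m * ?r + C * ?r + real m * C"
      using C r by (intro add_mono mult_left_mono mult_right_mono) auto
    finally show "(\<Sum>s\<in>?I. optimal_cost P (reversed s w) s) \<le> (real m + C) * ?r + real m * C"
      by (simp add: distrib_right)
  qed
qed

end

section \<open>Bounded random vectors\<close>

lemma borel_measurable_matrix_vector_mult [measurable]:
  fixes N :: "real^'n^'m"
  assumes "f \<in> borel_measurable M"
  shows "(\<lambda>x. N *v f x) \<in> borel_measurable M"
  using assms by (rule borel_measurable_continuous_on[rotated]) (intro continuous_intros)

lemma cesaro_mean_tendsto:
  fixes c :: "nat \<Rightarrow> real"
  assumes "c \<longlonglongrightarrow> L"
  shows "(\<lambda>T. (\<Sum>k<T. c k) / real T) \<longlonglongrightarrow> L"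
proof (rule LIMSEQ_I)
  fix e :: real assume e: "e > 0"
  obtain n where n: "\<And>k. k \<ge> n \<Longrightarrow> \<bar>c k - L\<bar> < e / 2"
    using LIMSEQ_D[OF assms, of "e / 2"] e by auto
  define C where "C = (\<Sum>k<n. \<bar>c k - L\<bar>)"
  have "(\<lambda>T. C / real T) \<longlonglongrightarrow> 0"
    by (rule lim_const_over_n)
  then have "eventually (\<lambda>T. C / real T < e / 2) sequentially"
    using e by (intro order_tendstoD(2)) auto
  then obtain m where m: "\<And>T. T \<ge> m \<Longrightarrow> C / real T < e / 2"
    by (auto simp: eventually_sequentially)
  show "\<exists>no. \<forall>T\<ge>no. norm ((\<Sum>k<T. c k) / real T - L) < e"
  proof (intro exI allI impI)
    fix T assume T: "T \<ge> max (Suc n) m"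
    have split: "{..<T} = {..<n} \<union> {n..<T}"
      using T by auto
    have "(\<Sum>k<T. c k) / real T - L = (\<Sum>k<T. c k - L) / real T"
      using T by (simp add: sum_subtractf field_simps)
    also have "norm \<dots> \<le> (\<Sum>k<T. \<bar>c k - L\<bar>) / real T"
      by (simp add: divide_right_mono sum_abs)
    also have "(\<Sum>k<T. \<bar>c k - L\<bar>) = C + (\<Sum>k=n..<T. \<bar>c k - L\<bar>)"
      unfolding C_def split by (rule sum.union_disjoint) auto
    also have "(\<Sum>k=n..<T. \<bar>c k - L\<bar>) \<le> (\<Sum>k=n..<T. e / 2)"
      using n by (intro sum_mono) (auto intro: less_imp_le)
    also have "\<dots> \<le> real T * (e / 2)"
      using e by (simp add: mult_right_mono)
    also have "(C + real T * (e / 2)) / real T = C / real T + e / 2"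
      using T by (simp add: field_simps)
    also have "\<dots> < e"
    proof -
      have "C / real T < e / 2"
        using m T by simp
      then show ?thesis
        by linarith
    qed
    finally show "norm ((\<Sum>k<T. c k) / real T - L) < e"
      using T by (simp add: divide_right_mono)
  qed
qed

text \<open>
  The complement of the support is a union of open null sets, of which countably many suffice
  because the space is second countable. Hence the random vector lies in its support almost surely.
\<close>

lemma (in prob_space) AE_in_bounded_support:
  fixes X :: "'a \<Rightarrow> 'b::{real_normed_vector, second_countable_topology}"
  assumes X: "X \<in> borel_measurable M" and bdd: "bounded (measure_support (distr M borel X))"
  obtains b where "AE x in M. norm (X x) \<le> b"
proof -
  let ?D = "distr M borel X"
  obtain b where b: "\<And>x. x \<in> measure_support ?D \<Longrightarrow> norm x \<le> b"
    using bdd by (auto simp: bounded_iff)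
  let ?F = "{U. open U \<and> emeasure ?D U = 0}"
  obtain F' where F': "F' \<subseteq> ?F" "countable F'" "\<Union>F' = \<Union>?F"
    using Lindelof_openin[of ?F UNIV] by auto
  have "\<Union>F' \<in> null_sets ?D"
  proof (rule null_sets_UN'[of F' "\<lambda>U. U", simplified])
    show "U \<in> null_sets ?D" if "U \<in> F'" for U
      using that F'(1) by (auto simp: null_sets_def)
  qed (rule F'(2))
  moreover have "x \<in> \<Union>F'" if "\<not> norm x \<le> b" for x
  proof -
    have "x \<notin> measure_support ?D"
      using b that by blast
    then obtain U where "open U" "x \<in> U" "\<not> emeasure ?D U > 0"
      by (auto simp: measure_support_def)
    then show ?thesis
      unfolding F'(3) by auto
  qed
  ultimately have "AE x in ?D. norm x \<le> b"
    by (intro AE_I[of _ _ "\<Union>F'"]) (auto simp: null_sets_def)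
  then have "AE x in M. norm (X x) \<le> b"
    using X by (subst (asm) AE_distr_iff) auto
  then show thesis
    by (rule that)
qed

context prob_space
begin

text \<open>
  A class of random vectors that is closed under linear maps and under products, and on which all
  expectations exist. Everything derived from the noise below is built by these operations.
\<close>

definition bounded_rv :: "('a \<Rightarrow> 'b::euclidean_space) \<Rightarrow> bool" where
  "bounded_rv f \<longleftrightarrow> f \<in> borel_measurable M \<and> (\<exists>c. AE x in M. norm (f x) \<le> c)"

lemma bounded_rv_measurable: "bounded_rv f \<Longrightarrow> f \<in> borel_measurable M"
  by (simp add: bounded_rv_def)

lemma bounded_rv_integrable: "bounded_rv f \<Longrightarrow> integrable M f"
  using integrable_const_bound by (auto simp: bounded_rv_def)

lemma bounded_rv_const [intro]: "bounded_rv (\<lambda>_. c)"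
  by (auto simp: bounded_rv_def)

lemma bounded_rv_add [intro]:
  assumes "bounded_rv f" "bounded_rv g"
  shows "bounded_rv (\<lambda>x. f x + g x)"
proof -
  obtain c d where "AE x in M. norm (f x) \<le> c" "AE x in M. norm (g x) \<le> d"
    using assms by (auto simp: bounded_rv_def)
  then have "AE x in M. norm (f x + g x) \<le> c + d"
    by eventually_elim (rule norm_triangle_mono)
  then show ?thesis
    using assms by (auto simp: bounded_rv_def)
qed

lemma bounded_rv_bounded_linear:
  assumes "bounded_linear h" "bounded_rv f"
  shows "bounded_rv (\<lambda>x. h (f x))"
proof -
  obtain c where c: "AE x in M. norm (f x) \<le> c"
    using assms by (auto simp: bounded_rv_def)
  obtain K where K: "K \<ge> 0" "\<And>y. norm (h y) \<le> norm y * K"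
    using bounded_linear.nonneg_bounded[OF assms(1)] by blast
  from c have "AE x in M. norm (h (f x)) \<le> c * K"
  proof eventually_elim
    case (elim x)
    then show ?case
      using K(2)[of "f x"] mult_right_mono[OF elim K(1)] by linarith
  qed
  moreover have "(\<lambda>x. h (f x)) \<in> borel_measurable M"
    using assms(2)
    by (intro borel_measurable_continuous_on[OF linear_continuous_on[OF assms(1)]])
       (simp add: bounded_rv_def)
  ultimately show ?thesis
    by (auto simp: bounded_rv_def)
qed

lemma bounded_rv_matrix [intro]:
  fixes N :: "real^'n^'m"
  shows "bounded_rv f \<Longrightarrow> bounded_rv (\<lambda>x. N *v f x)"
  by (rule bounded_rv_bounded_linear) auto

lemma bounded_rv_uminus [intro]: "bounded_rv f \<Longrightarrow> bounded_rv (\<lambda>x. - f x)"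
  by (rule bounded_rv_bounded_linear) (rule bounded_linear_minus[OF bounded_linear_ident])

lemma bounded_rv_diff [intro]:
  "bounded_rv f \<Longrightarrow> bounded_rv g \<Longrightarrow> bounded_rv (\<lambda>x. f x - g x)"
  using bounded_rv_add[of f "\<lambda>x. - g x"] by (simp add: bounded_rv_uminus)

lemma bounded_rv_inner [intro]:
  assumes "bounded_rv f" "bounded_rv g"
  shows "bounded_rv (\<lambda>x. f x \<bullet> g x)"
proof -
  obtain c d where "AE x in M. norm (f x) \<le> c" "AE x in M. norm (g x) \<le> d"
    using assms by (auto simp: bounded_rv_def)
  then have "AE x in M. norm (f x \<bullet> g x) \<le> c * d"
  proof eventually_elim
    case (elim x)
    have "norm (f x \<bullet> g x) \<le> norm (f x) * norm (g x)"
      by (simp add: Cauchy_Schwarz_ineq2)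
    also have "\<dots> \<le> c * d"
      using elim by (intro mult_mono) (auto intro: order_trans[OF norm_ge_zero])
    finally show ?case .
  qed
  then show ?thesis
    using assms by (auto simp: bounded_rv_def)
qed

lemma bounded_rv_mult [intro]:
  fixes f g :: "'a \<Rightarrow> real"
  shows "bounded_rv f \<Longrightarrow> bounded_rv g \<Longrightarrow> bounded_rv (\<lambda>x. f x * g x)"
  using bounded_rv_inner[of f g] by simp

lemma bounded_rv_sum [intro]:
  "(\<And>i. i \<in> I \<Longrightarrow> bounded_rv (f i)) \<Longrightarrow> bounded_rv (\<lambda>x. \<Sum>i\<in>I. f i x)"
  by (induction I rule: infinite_finite_induct) (auto intro: bounded_rv_const bounded_rv_add)

text \<open>
  Expanding y \<bullet> N z over coordinate vectors reduces it to the given second moments.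
\<close>

lemma expectation_bilinear_form:
  fixes y z :: "'a \<Rightarrow> real^'n" and C N :: "real^'n^'n"
  assumes "bounded_rv y" "bounded_rv z"
    and "\<And>a c. expectation (\<lambda>x. (a \<bullet> y x) * (c \<bullet> z x)) = a \<bullet> (C *v c)"
  shows "expectation (\<lambda>x. y x \<bullet> (N *v z x)) = trace (C ** transpose N)"
proof -
  have "y x \<bullet> (N *v z x) = (\<Sum>i\<in>UNIV. (axis i 1 \<bullet> y x) * ((transpose N *v axis i 1) \<bullet> z x))" for x
    by (simp add: inner_matrix_left inner_axis') (simp add: inner_vec_def)
  moreover have "integrable M (\<lambda>x. (a \<bullet> y x) * (c \<bullet> z x))" for a c
    using assms(1,2) by (intro bounded_rv_integrable bounded_rv_mult bounded_rv_inner bounded_rv_const)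
  ultimately have "expectation (\<lambda>x. y x \<bullet> (N *v z x))
      = (\<Sum>i\<in>UNIV. axis i 1 \<bullet> (C *v (transpose N *v axis i 1)))"
    by (simp add: assms(3))
  also have "\<dots> = trace (C ** transpose N)"
    unfolding trace_def
    by (simp add: matrix_vector_mul_assoc inner_axis' matrix_vector_mul_component inner_axis)
  finally show ?thesis .
qed

end

section \<open>Expected optimal cost under white noise\<close>

text \<open>
  Expected costs are quadratic in the noise, so they are determined by its second moments; the
  independence of the noise vectors enters through the vanishing of the mixed moments.
\<close>

locale white_noise = prob_space M
  for M :: "'o measure" +
  fixes w :: "nat \<Rightarrow> 'o \<Rightarrow> real^'n" and W :: "real^'n^'n" and b :: real
  assumes noise_measurable: "\<And>t. w t \<in> borel_measurable M"
    and noise_bounded: "\<And>t. AE x in M. norm (w t x) \<le> b"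
    and noise_moments: "\<And>s t a c. expectation (\<lambda>x. (a \<bullet> w s x) * (c \<bullet> w t x))
                          = (if s = t then a \<bullet> (W *v c) else 0)"
begin

lemma noise_bounded_rv: "bounded_rv (w t)"
  using noise_measurable noise_bounded by (auto simp: bounded_rv_def)

text \<open>
  The trace is the expectation of the form of Z at a noise vector.
\<close>

lemma trace_covariance_psd_nonneg:
  assumes "sym_psd Z"
  shows "0 \<le> trace (W ** Z)"
proof -
  have "expectation (\<lambda>x. w 0 x \<bullet> (Z *v w 0 x)) = trace (W ** transpose Z)"
    by (intro expectation_bilinear_form noise_bounded_rv) (simp add: noise_moments)
  moreover have "0 \<le> expectation (\<lambda>x. w 0 x \<bullet> (Z *v w 0 x))"
    using assms by (intro Bochner_Integration.integral_nonneg) (auto simp: sym_psd_def)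
  ultimately show ?thesis
    using assms by (simp add: sym_psd_def)
qed

end

locale lqr_white_noise = lqr_stabilizable A B Q R P + white_noise M w W b
  for A :: "real^'n^'n" and B :: "real^'m^'n" and Q :: "real^'n^'n" and R :: "real^'m^'m"
    and P :: "real^'n^'n" and M :: "'o measure" and w :: "nat \<Rightarrow> 'o \<Rightarrow> real^'n"
    and W :: "real^'n^'n" and b :: real
begin

text \<open>
  The covariance of the costate after one more step: the old costate and the new noise vector are
  uncorrelated, so the two contributions add.
\<close>

definition cov_step :: "real^'n^'n \<Rightarrow> real^'n^'n \<Rightarrow> real^'n^'n" where
  "cov_step X C = transpose (closed_loop X) ** C ** closed_loop X
     + transpose A ** schur X ** W ** schur X ** A"

primrec costate_cov :: "real^'n^'n \<Rightarrow> nat \<Rightarrow> real^'n^'n" where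
  "costate_cov X 0 = 0"
| "costate_cov X (Suc k) = cov_step ((riccati ^^ k) X) (costate_cov X k)"

text \<open>
  The contribution to the costate covariance of the N noise vectors absorbed last. For fixed N this
  involves only the last N closed-loop matrices, so it converges along with them, whatever the size
  of the full covariance.
\<close>

primrec recent_cov :: "real^'n^'n \<Rightarrow> nat \<Rightarrow> nat \<Rightarrow> real^'n^'n" where
  "recent_cov X 0 k = 0"
| "recent_cov X (Suc N) k =
     (case k of 0 \<Rightarrow> 0 | Suc k' \<Rightarrow> cov_step ((riccati ^^ k') X) (recent_cov X N k'))"

lemma cov_step_form:
  assumes "sym_psd X"
  shows "a \<bullet> (cov_step X C *v c) = (closed_loop X *v a) \<bullet> (C *v (closed_loop X *v c))
    + (schur X *v (A *v a)) \<bullet> (W *v (schur X *v (A *v c)))"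
  using schur_sym[OF assms]
  by (simp add: cov_step_def matrix_vector_mult_add_rdistrib inner_add_right
      matrix_vector_mul_assoc[symmetric] inner_matrix_left)

lemma costate_step_inner:
  assumes "sym_psd X"
  shows "a \<bullet> costate_step X v z = (closed_loop X *v a) \<bullet> v + (schur X *v (A *v a)) \<bullet> z"
  using schur_sym[OF assms]
  by (simp add: costate_step_def inner_add_right inner_matrix_left)

abbreviation costate_rv :: "real^'n^'n \<Rightarrow> nat \<Rightarrow> nat \<Rightarrow> 'o \<Rightarrow> real^'n" where
  "costate_rv X T k x \<equiv> costate X (reversed T (\<lambda>t. w t x)) k"

lemma costate_bounded_rv: "bounded_rv (costate_rv X T k)"
proof (induction k)
  case (Suc k)
  then show ?case
    unfolding costate.simps costate_step_def reversed_def
    by (intro bounded_rv_add bounded_rv_matrix noise_bounded_rv)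
qed (simp add: bounded_rv_const)

text \<open>
  The costate with k steps to go depends only on the last k noise vectors, and is therefore
  uncorrelated with the first T - k. Both claims are proved together because the cross
  terms of the covariance in the next step vanish by the first one.
\<close>

lemma costate_moments:
  assumes X: "sym_psd X" and "k \<le> T"
  shows "(\<forall>a c. \<forall>j<T - k. expectation (\<lambda>x. (a \<bullet> costate_rv X T k x) * (c \<bullet> w j x)) = 0)
    \<and> (\<forall>a c. expectation (\<lambda>x. (a \<bullet> costate_rv X T k x) * (c \<bullet> costate_rv X T k x))
          = a \<bullet> (costate_cov X k *v c))"
  using assms(2)
proof (induction k)
  case 0
  then show ?case
    by simp
next
  case (Suc k)
  let ?X = "(riccati ^^ k) X" and ?t = "T - Suc k"
  have Xk: "sym_psd ?X"
    by (rule riccati_iter_psd[OF X])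
  have v: "bounded_rv (costate_rv X T k)"
    by (rule costate_bounded_rv)
  have int: "integrable M (\<lambda>x. (a \<bullet> f x) * (c \<bullet> g x))"
    if "bounded_rv f" "bounded_rv g" for a c and f g :: "'o \<Rightarrow> real^'n"
    using that by (intro bounded_rv_integrable bounded_rv_mult bounded_rv_inner bounded_rv_const)
  note ints = int[OF v v] int[OF v noise_bounded_rv] int[OF noise_bounded_rv v]
    int[OF noise_bounded_rv noise_bounded_rv]
  have step: "a \<bullet> costate_rv X T (Suc k) x = (closed_loop ?X *v a) \<bullet> costate_rv X T k x
      + (schur ?X *v (A *v a)) \<bullet> w ?t x" for a x
    using costate_step_inner[OF Xk] by (simp add: reversed_def)
  have cross: "expectation (\<lambda>x. (a \<bullet> costate_rv X T k x) * (c \<bullet> w j x)) = 0" if "j \<le> ?t" for a c j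
    using Suc that by auto
  have cross': "expectation (\<lambda>x. (c \<bullet> w j x) * (a \<bullet> costate_rv X T k x)) = 0" if "j \<le> ?t" for a c j
    using cross[OF that] by (simp add: mult.commute)
  have square: "expectation (\<lambda>x. (a \<bullet> costate_rv X T k x) * (c \<bullet> costate_rv X T k x))
          = a \<bullet> (costate_cov X k *v c)" for a c
    using Suc by simp
  show ?case
  proof (intro conjI allI impI)
    fix a c j assume j: "j < T - Suc k"
    show "expectation (\<lambda>x. (a \<bullet> costate_rv X T (Suc k) x) * (c \<bullet> w j x)) = 0"
      unfolding step using j by (simp add: distrib_right ints cross noise_moments)
  next
    fix a c
    show "expectation (\<lambda>x. (a \<bullet> costate_rv X T (Suc k) x) * (c \<bullet> costate_rv X T (Suc k) x))
          = a \<bullet> (costate_cov X (Suc k) *v c)"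
      unfolding step
      by (simp add: distrib_right distrib_left ints cross cross' square noise_moments
          cov_step_form[OF Xk])
  qed
qed

lemma optimal_cost_bounded_rv: "bounded_rv (\<lambda>x. optimal_cost X (reversed T (\<lambda>t. w t x)) T)"
proof -
  have "bounded_rv (\<lambda>x. offset Y (costate_rv X T k x) (reversed T (\<lambda>t. w t x) k))" for Y k
    unfolding offset_def reversed_def
    by (intro bounded_rv_add bounded_rv_diff bounded_rv_inner bounded_rv_mult bounded_rv_const
        bounded_rv_matrix noise_bounded_rv costate_bounded_rv[unfolded reversed_def])
  then show ?thesis
    unfolding optimal_cost_def by (intro bounded_rv_sum)
qed

definition expected_stage :: "real^'n^'n \<Rightarrow> real^'n^'n \<Rightarrow> real" where
  "expected_stage X C = trace (W ** schur X) - trace (ctrl X ** C)"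

text \<open>
  In the offset, the form of the current noise vector contributes the first trace of the expected
  stage cost and the form of the costate the second; the mixed term has mean zero.
\<close>

lemma expectation_optimal_cost:
  assumes X: "sym_psd X"
  shows "expectation (\<lambda>x. optimal_cost X (reversed T (\<lambda>t. w t x)) T)
    = (\<Sum>k<T. expected_stage ((riccati ^^ k) X) (costate_cov X k))"
proof -
  have stage: "expectation (\<lambda>x. offset ((riccati ^^ k) X) (costate_rv X T k x)
        (reversed T (\<lambda>t. w t x) k)) = expected_stage ((riccati ^^ k) X) (costate_cov X k)"
    (is "expectation (\<lambda>x. offset ?X (?v x) _) = _")
    and int: "integrable M (\<lambda>x. offset ((riccati ^^ k) X) (costate_rv X T k x)
        (reversed T (\<lambda>t. w t x) k))"
    if k: "k < T" for k
  proof -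
    let ?N = "mat 1 - ctrl ?X ** ?X" and ?w = "w (T - Suc k)"
    have Xk: "sym_psd ?X"
      by (rule riccati_iter_psd[OF X])
    have off: "offset ?X (?v x) (reversed T (\<lambda>t. w t x) k)
        = ?w x \<bullet> (schur ?X *v ?w x) + 2 * (?v x \<bullet> (?N *v ?w x)) - ?v x \<bullet> (ctrl ?X *v ?v x)" for x
      by (simp add: offset_def reversed_def matrix_vector_mult_diff_rdistrib
          matrix_vector_mul_assoc)
    have int_form: "integrable M (\<lambda>x. f x \<bullet> (Y *v g x))"
      if "bounded_rv f" "bounded_rv g" for f g :: "'o \<Rightarrow> real^'n" and Y :: "real^'n^'n"
      using that by (intro bounded_rv_integrable bounded_rv_inner bounded_rv_matrix)
    note ints = int_form[OF noise_bounded_rv noise_bounded_rv]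
      int_form[OF costate_bounded_rv noise_bounded_rv]
      int_form[OF costate_bounded_rv costate_bounded_rv]
    show "integrable M (\<lambda>x. offset ?X (?v x) (reversed T (\<lambda>t. w t x) k))"
      unfolding off by (intro Bochner_Integration.integrable_add Bochner_Integration.integrable_diff
          integrable_mult_right ints)
    have "expectation (\<lambda>x. ?w x \<bullet> (schur ?X *v ?w x)) = trace (W ** transpose (schur ?X))"
      by (intro expectation_bilinear_form noise_bounded_rv) (simp add: noise_moments)
    moreover have "expectation (\<lambda>x. ?v x \<bullet> (?N *v ?w x)) = trace (0 ** transpose ?N)"
      using costate_moments[OF X, of k T] k
      by (intro expectation_bilinear_form noise_bounded_rv costate_bounded_rv) simp
    moreover have "expectation (\<lambda>x. ?v x \<bullet> (ctrl ?X *v ?v x))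
        = trace (costate_cov X k ** transpose (ctrl ?X))"
      using costate_moments[OF X, of k T] k
      by (intro expectation_bilinear_form costate_bounded_rv) simp
    moreover have "transpose (ctrl ?X) = ctrl ?X"
      using ctrl_psd[OF Xk] by (simp add: sym_psd_def)
    ultimately show "expectation (\<lambda>x. offset ?X (?v x) (reversed T (\<lambda>t. w t x) k))
        = expected_stage ?X (costate_cov X k)"
      unfolding off
      by (simp add: ints schur_sym[OF Xk] expected_stage_def trace_mul_sym[of "costate_cov X k"])
         (simp add: trace_def matrix_matrix_mult_def)
  qed
  show ?thesis
    unfolding optimal_cost_def by (simp add: stage int)
qed

text \<open>
  The dual view of a covariance step: the weight Z is transported instead of the covariance. It
  leaves a trace against W, whose sign is known for positive semidefinite matrices.
\<close>

lemma trace_cov_step: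
  "trace (Z ** cov_step X C) = trace ((closed_loop X ** Z ** transpose (closed_loop X)) ** C)
     + trace (W ** (schur X ** A ** Z ** transpose A ** schur X))"
proof -
  have "trace (Z ** (transpose (closed_loop X) ** C ** closed_loop X))
      = trace ((closed_loop X ** Z ** transpose (closed_loop X)) ** C)"
    using trace_mul_sym[of "Z ** transpose (closed_loop X) ** C" "closed_loop X"]
    by (simp only: matrix_mul_assoc)
  moreover have "trace (Z ** (transpose A ** schur X ** W ** schur X ** A))
      = trace (W ** (schur X ** A ** Z ** transpose A ** schur X))"
    using trace_mul_sym[of "Z ** transpose A ** schur X" "W ** schur X ** A"]
    by (simp only: matrix_mul_assoc)
  ultimately show ?thesis
    by (simp add: cov_step_def matrix_add_ldistrib trace_add)
qed

lemma
  assumes X: "sym_psd X" and Z: "sym_psd Z"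
  shows cov_step_weight_psd: "sym_psd (closed_loop X ** Z ** transpose (closed_loop X))"
    and cov_step_injection_nonneg:
      "0 \<le> trace (W ** (schur X ** A ** Z ** transpose A ** schur X))"
proof -
  show "sym_psd (closed_loop X ** Z ** transpose (closed_loop X))"
    using sym_psd_congruence[OF Z, of "transpose (closed_loop X)"] by simp
  have "sym_psd (schur X ** A ** Z ** transpose A ** schur X)"
    using sym_psd_congruence[OF Z, of "transpose A ** schur X"] schur_sym[OF X]
    by (simp add: matrix_transpose_mul matrix_mul_assoc)
  then show "0 \<le> trace (W ** (schur X ** A ** Z ** transpose A ** schur X))"
    by (rule trace_covariance_psd_nonneg)
qed

lemma trace_zero: "trace (0 :: real^'n^'n) = 0"
  by (simp add: trace_def)

text \<open>
  Every noise vector contributes nonnegatively to a positive semidefinite weight of the covariance,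
  so forgetting the older ones lowers it.
\<close>

lemma trace_recent_cov_le:
  assumes X: "sym_psd X" and Z: "sym_psd Z"
  shows "trace (Z ** recent_cov X N k) \<le> trace (Z ** costate_cov X k)"
  using Z
proof (induction k arbitrary: N Z)
  case 0
  then show ?case
    by (cases N) simp_all
next
  case (Suc k)
  have Xk: "sym_psd ((riccati ^^ k) X)"
    by (rule riccati_iter_psd[OF X])
  note weight = cov_step_weight_psd[OF Xk Suc.prems]
  show ?case
  proof (cases N)
    case 0
    then show ?thesis
      using Suc.IH[OF weight, of 0] cov_step_injection_nonneg[OF Xk Suc.prems]
      by (simp add: trace_cov_step trace_zero)
  next
    case (Suc N')
    then show ?thesis
      using Suc.IH[OF weight, of N'] by (simp add: trace_cov_step)
  qed
qed

lemma tendsto_recent_cov: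
  assumes X: "sym_psd X" and lim: "(\<lambda>k. (riccati ^^ k) X) \<longlonglongrightarrow> P"
  shows "recent_cov X N \<longlonglongrightarrow> costate_cov P N"
proof (induction N)
  case 0
  have "recent_cov X 0 = (\<lambda>_. 0)"
    by auto
  then show ?case
    by simp
next
  case (Suc N)
  have "(\<lambda>k. cov_step ((riccati ^^ k) X) (recent_cov X N k)) \<longlonglongrightarrow> cov_step P (costate_cov P N)"
    unfolding cov_step_def
    by (intro tendsto_intros tendsto_schur[OF lim] tendsto_closed_loop[OF lim] Suc
        riccati_iter_psd[OF X])
  then have "(\<lambda>k. recent_cov X (Suc N) (Suc k)) \<longlonglongrightarrow> costate_cov P (Suc N)"
    by (simp add: P_iter)
  then show ?case
    by (rule LIMSEQ_imp_Suc)
qed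

text \<open>
  At the fixed point the closed loop is the same in every step, so the transported weight is a
  conjugate of Z by a power of it, and the covariance is a geometric sum.
\<close>

lemma trace_stationary_cov:
  "trace (Z ** costate_cov P N) = (\<Sum>i<N. trace (W ** (schur P ** A ** mat_pow (closed_loop P) i ** Z
     ** mat_pow (transpose (closed_loop P)) i ** transpose A ** schur P)))"
proof (induction N arbitrary: Z)
  case 0
  then show ?case
    by (simp add: trace_zero)
next
  case (Suc N)
  let ?F = "closed_loop P"
  have "mat_pow ?F i ** (?F ** Z ** transpose ?F) ** mat_pow (transpose ?F) i
      = mat_pow ?F (Suc i) ** Z ** mat_pow (transpose ?F) (Suc i)" for i
    unfolding mat_pow_Suc_right[of ?F] by (simp add: matrix_mul_assoc)
  then have "schur P ** A ** (mat_pow ?F i ** (?F ** Z ** transpose ?F) ** mat_pow (transpose ?F) i)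
        ** transpose A ** schur P
      = schur P ** A ** (mat_pow ?F (Suc i) ** Z ** mat_pow (transpose ?F) (Suc i))
        ** transpose A ** schur P" for i
    by (simp only:)
  then have "schur P ** A ** mat_pow ?F i ** (?F ** Z ** transpose ?F) ** mat_pow (transpose ?F) i
        ** transpose A ** schur P
      = schur P ** A ** mat_pow ?F (Suc i) ** Z ** mat_pow (transpose ?F) (Suc i)
        ** transpose A ** schur P" for i
    by (simp only: matrix_mul_assoc)
  then show ?case
    unfolding sum.lessThan_Suc_shift
    by (simp add: P_iter trace_cov_step Suc del: mat_pow.simps(2))
qed

end

section \<open>Upper and lower bounds for the mean cost\<close>

context lqr_white_noise
begin

abbreviation noise :: "'o \<Rightarrow> nat \<Rightarrow> real^'n" where
  "noise x \<equiv> (\<lambda>t. w t x)"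

lemma optimal_control_measurable:
  assumes "f \<in> borel_measurable M"
  shows "(\<lambda>x. optimal_control X T (noise x) (f x) t) \<in> borel_measurable M"
proof -
  have [measurable]: "costate_rv X T k \<in> borel_measurable M" for k
    by (intro bounded_rv_measurable costate_bounded_rv)
  note [measurable] = assms noise_measurable
  show ?thesis
    unfolding optimal_control_def policy_def by measurable
qed

lemma optimal_trajectory_measurable:
  assumes Qf: "sym_psd Qf"
    and opt: "\<And>x. x \<in> space M \<Longrightarrow> offline_optimal A B Q R Qf T (noise x) (u x)"
    and "t < T"
  shows "(\<lambda>x. lin_state A B (noise x) (u x) t) \<in> borel_measurable M"
    and "(\<lambda>x. u x t) \<in> borel_measurable M"
proof -
  have control: "(\<lambda>x. u x t) \<in> borel_measurable M"
    if "t < T" "(\<lambda>x. lin_state A B (noise x) (u x) t) \<in> borel_measurable M" for t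
  proof (subst measurable_cong)
    show "u x t = optimal_control Qf T (noise x) (lin_state A B (noise x) (u x) t) t"
      if "x \<in> space M" for x
      using offline_optimal_control[OF Qf opt] that \<open>t < T\<close> by blast
    show "(\<lambda>x. optimal_control Qf T (noise x) (lin_state A B (noise x) (u x) t) t)
        \<in> borel_measurable M"
      by (rule optimal_control_measurable) (rule that)
  qed
  show state: "(\<lambda>x. lin_state A B (noise x) (u x) t) \<in> borel_measurable M"
    using \<open>t < T\<close>
  proof (induction t)
    case (Suc t)
    then have [measurable]: "(\<lambda>x. lin_state A B (noise x) (u x) t) \<in> borel_measurable M"
      by simp
    have [measurable]: "(\<lambda>x. u x t) \<in> borel_measurable M"
      using Suc by (intro control) auto
    note [measurable] = noise_measurable
    show ?case
      unfolding lin_state.simps by measurable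
  qed simp
  show "(\<lambda>x. u x t) \<in> borel_measurable M"
    by (rule control[OF \<open>t < T\<close> state])
qed

lemma running_cost_nonneg: "0 \<le> running_cost A B Q R T w' u"
  unfolding running_cost_def by (intro sum_nonneg stage_cost_nonneg)

text \<open>
  The optimal sequence for Qf is compared with the one for Z: raising the terminal cost from 0 to Qf
  and then to Z only raises the costs, and the minimum for Z is known explicitly.
\<close>

lemma optimal_running_cost_le:
  assumes Qf: "sym_psd Qf" and Z: "sym_psd Z" and le: "\<And>x. x \<bullet> (Qf *v x) \<le> x \<bullet> (Z *v x)"
    and opt: "offline_optimal A B Q R Qf T w' u"
  shows "running_cost A B Q R T w' u \<le> optimal_cost Z (reversed T w') T"
proof -
  obtain v where v: "horizon_cost A B Q R Z T w' v = optimal_cost Z (reversed T w') T"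
    using optimal_cost_attained[OF Z] by blast
  have "running_cost A B Q R T w' u \<le> horizon_cost A B Q R Qf T w' u"
    using Qf by (simp add: horizon_cost_def sym_psd_def)
  also have "\<dots> \<le> horizon_cost A B Q R Qf T w' v"
    using opt by (simp add: offline_optimal_def is_arg_min_linorder)
  also have "\<dots> \<le> horizon_cost A B Q R Z T w' v"
    using le by (simp add: horizon_cost_def)
  finally show ?thesis
    using v by simp
qed

lemma optimal_running_cost_bounded_rv:
  assumes Qf: "sym_psd Qf"
    and opt: "\<And>x. x \<in> space M \<Longrightarrow> offline_optimal A B Q R Qf T (noise x) (u x)"
  shows "bounded_rv (\<lambda>x. running_cost A B Q R T (noise x) (u x))"
proof -
  have "(\<lambda>x. running_cost A B Q R T (noise x) (u x)) \<in> borel_measurable M"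
    unfolding running_cost_def
    by (intro borel_measurable_sum borel_measurable_add borel_measurable_inner
        borel_measurable_matrix_vector_mult optimal_trajectory_measurable[OF Qf opt]) auto
  moreover obtain c where "AE x in M. norm (optimal_cost Qf (reversed T (noise x)) T) \<le> c"
    using optimal_cost_bounded_rv by (auto simp: bounded_rv_def)
  then have "AE x in M. norm (running_cost A B Q R T (noise x) (u x)) \<le> c"
    using AE_space
  proof eventually_elim
    case (elim x)
    then show ?case
      using optimal_running_cost_le[OF Qf Qf order_refl opt, of x]
        running_cost_nonneg[of T "noise x" "u x"] by simp
  qed
  ultimately show ?thesis
    by (auto simp: bounded_rv_def)
qed

text \<open>
  What foresight of the noise i + 1 steps ahead saves per stage: the i-th term of the series.
\<close>

definition loss_term :: "nat \<Rightarrow> real" where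
  "loss_term i = trace (W ** (schur P ** A ** mat_pow (closed_loop P) i ** ctrl P
     ** mat_pow (transpose (closed_loop P)) i ** transpose A ** schur P))"

lemma loss_term_nonneg: "0 \<le> loss_term i"
proof -
  have pow: "transpose (mat_pow (closed_loop P) i) = mat_pow (transpose (closed_loop P)) i"
    by (induction i) (simp_all add: matrix_transpose_mul mat_pow_Suc_right del: mat_pow.simps(2),
        simp add: mat_pow_Suc_right[symmetric])
  have "sym_psd (transpose (mat_pow (transpose (closed_loop P)) i ** transpose A ** schur P)
      ** ctrl P ** (mat_pow (transpose (closed_loop P)) i ** transpose A ** schur P))"
    by (intro sym_psd_congruence ctrl_psd P_psd)
  then have "sym_psd (schur P ** A ** mat_pow (closed_loop P) i ** ctrl P
     ** mat_pow (transpose (closed_loop P)) i ** transpose A ** schur P)"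
    using schur_sym[OF P_psd]
    by (simp add: matrix_transpose_mul matrix_mul_assoc pow[symmetric])
  then show ?thesis
    unfolding loss_term_def by (rule trace_covariance_psd_nonneg)
qed

lemma expected_stage_stationary:
  "expected_stage P (costate_cov P N) = trace (W ** schur P) - (\<Sum>i<N. loss_term i)"
  by (simp add: expected_stage_def trace_stationary_cov loss_term_def)

text \<open>
  The family u assigns an optimal sequence to each horizon and each outcome. Its measurability
  comes from the feedback law.
\<close>

context
  fixes Qf :: "real^'n^'n" and u :: "nat \<Rightarrow> 'o \<Rightarrow> nat \<Rightarrow> real^'m"
  assumes Qf: "sym_psd Qf"
    and opt: "\<And>T x. T \<ge> 1 \<Longrightarrow> x \<in> space M \<Longrightarrow> offline_optimal A B Q R Qf T (noise x) (u T x)"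
begin

definition mean_cost :: "nat \<Rightarrow> real" where
  "mean_cost T = expectation (\<lambda>x. running_cost A B Q R T (noise x) (u T x))"

lemma integrable_running_cost:
  "T \<ge> 1 \<Longrightarrow> integrable M (\<lambda>x. running_cost A B Q R T (noise x) (u T x))"
  by (intro bounded_rv_integrable optimal_running_cost_bounded_rv[OF Qf] opt)

text \<open>
  The bound keeps N fixed: the stage costs with truncated saving converge because P(k) does, and
  averaging over the horizon preserves the limit.
\<close>

lemma mean_cost_upper:
  "\<exists>g. g \<longlonglongrightarrow> trace (W ** schur P) - (\<Sum>i<N. loss_term i)
     \<and> (\<forall>T\<ge>1. mean_cost T / real T \<le> g T)"
proof -
  obtain Z where Z: "sym_psd Z" "\<And>x. x \<bullet> (Qf *v x) \<le> x \<bullet> (Z *v x)"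
    "(\<lambda>k. (riccati ^^ k) Z) \<longlonglongrightarrow> P"
    using dominating_terminal_cost[OF Qf] by blast
  define d where "d k = expected_stage ((riccati ^^ k) Z) (recent_cov Z N k)" for k
  have "d \<longlonglongrightarrow> expected_stage P (costate_cov P N)"
    unfolding d_def expected_stage_def
    by (intro tendsto_intros tendsto_schur[OF Z(3)] tendsto_ctrl[OF Z(3)] riccati_iter_psd[OF Z(1)]
        tendsto_recent_cov[OF Z(1,3)])
  then have "(\<lambda>T. (\<Sum>k<T. d k) / real T) \<longlonglongrightarrow> expected_stage P (costate_cov P N)"
    by (rule cesaro_mean_tendsto)
  moreover have "mean_cost T / real T \<le> (\<Sum>k<T. d k) / real T" if "T \<ge> 1" for T
  proof -
    have "mean_cost T \<le> expectation (\<lambda>x. optimal_cost Z (reversed T (noise x)) T)"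
      unfolding mean_cost_def using that
      by (intro integral_mono integrable_running_cost bounded_rv_integrable optimal_cost_bounded_rv
          optimal_running_cost_le[OF Qf Z(1,2)] opt)
    also have "\<dots> \<le> (\<Sum>k<T. d k)"
      unfolding expectation_optimal_cost[OF Z(1)] d_def expected_stage_def
      by (intro sum_mono diff_left_mono trace_recent_cov_le Z(1) ctrl_psd riccati_iter_psd)
    finally show ?thesis
      by (simp add: divide_right_mono)
  qed
  ultimately show ?thesis
    unfolding expected_stage_stationary by blast
qed

text \<open>
  The mean cost is nonnegative, hence so is the limit of its upper bounds.
\<close>

lemma partial_loss_le: "(\<Sum>i<N. loss_term i) \<le> trace (W ** schur P)"
proof -
  obtain g where g: "g \<longlonglongrightarrow> trace (W ** schur P) - (\<Sum>i<N. loss_term i)"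
    "\<And>T. T \<ge> 1 \<Longrightarrow> mean_cost T / real T \<le> g T"
    using mean_cost_upper by blast
  have "0 \<le> mean_cost T / real T" for T
    unfolding mean_cost_def
    by (intro divide_nonneg_nonneg Bochner_Integration.integral_nonneg running_cost_nonneg) simp
  then have "\<exists>n. \<forall>T\<ge>n. 0 \<le> g T"
    using g(2) order_trans by blast
  then show ?thesis
    using LIMSEQ_le_const[OF g(1), of 0] by simp
qed

lemma summable_loss: "summable loss_term"
  by (rule bounded_imp_summable[of _ "trace (W ** schur P)"])
     (auto simp: loss_term_nonneg partial_loss_le lessThan_Suc_atMost[symmetric]
       simp del: sum.lessThan_Suc)

text \<open>
  Expectation of the window inequality. With terminal matrix P the expected cost of every stage
  is at least the limit L, since the partial sums of the savings stay below the whole series; horizon s thus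
  costs at least s L, and the times in the window differ from T by at most n.
\<close>

lemma mean_cost_lower:
  defines "L \<equiv> trace (W ** schur P) - suminf loss_term"
  shows "\<exists>C\<ge>0. \<forall>m. \<exists>n. \<forall>T\<ge>n.
    real m / (real m + C + 1) * ((real T - real n) / real T * L - C / real T) \<le> mean_cost T / real T"
proof -
  obtain k C where C: "C \<ge> 0" and window: "\<And>w u T m. \<forall>t. norm (w t) \<le> b \<Longrightarrow> m + k \<le> T \<Longrightarrow>
       (\<Sum>s\<in>{T-k-m..<T-k}. optimal_cost P (reversed s w) s)
         \<le> (real m + C) * running_cost A B Q R T w u + real m * C"
    using optimal_cost_window_le[of b] by blast
  have L: "0 \<le> L"
    unfolding L_def using suminf_le_const[OF summable_loss partial_loss_le] by simp
  have E_ge: "real s * L \<le> expectation (\<lambda>x. optimal_cost P (reversed s (noise x)) s)" for s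
  proof -
    have "(\<Sum>k<s. L) \<le> (\<Sum>k<s. expected_stage P (costate_cov P k))"
      unfolding expected_stage_stationary L_def
      by (intro sum_mono diff_left_mono sum_le_suminf summable_loss) (auto simp: loss_term_nonneg)
    then show ?thesis
      by (simp add: expectation_optimal_cost[OF P_psd] P_iter)
  qed
  have "real m / (real m + C + 1) * ((real T - real (m + k + 1)) / real T * L - C / real T)
      \<le> mean_cost T / real T" if T: "T \<ge> m + k + 1" for m T
  proof -
    let ?I = "{T-k-m..<T-k}"
    have AE_noise: "AE x in M. \<forall>t. norm (w t x) \<le> b"
      using noise_bounded by (simp add: AE_all_countable)
    have mean_nonneg: "0 \<le> mean_cost T"
      unfolding mean_cost_def by (intro Bochner_Integration.integral_nonneg running_cost_nonneg)
    have "real m * ((real T - real (m + k + 1)) * L) = (\<Sum>s\<in>?I. (real T - real (m + k + 1)) * L)"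
      using T by simp
    also have "\<dots> \<le> (\<Sum>s\<in>?I. real s * L)"
      using L by (intro sum_mono mult_right_mono) auto
    also have "\<dots> \<le> (\<Sum>s\<in>?I. expectation (\<lambda>x. optimal_cost P (reversed s (noise x)) s))"
      by (intro sum_mono E_ge)
    also have "\<dots> = expectation (\<lambda>x. \<Sum>s\<in>?I. optimal_cost P (reversed s (noise x)) s)"
      by (intro Bochner_Integration.integral_sum[symmetric] bounded_rv_integrable
          optimal_cost_bounded_rv)
    also have "\<dots> \<le> expectation
        (\<lambda>x. (real m + C) * running_cost A B Q R T (noise x) (u T x) + real m * C)"
    proof (rule integral_mono_AE)
      show "AE x in M. (\<Sum>s\<in>?I. optimal_cost P (reversed s (noise x)) s)
          \<le> (real m + C) * running_cost A B Q R T (noise x) (u T x) + real m * C"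
        using AE_noise
      proof eventually_elim
        case (elim x)
        then show ?case
          using T by (intro window) auto
      qed
      show "integrable M (\<lambda>x. \<Sum>s\<in>?I. optimal_cost P (reversed s (noise x)) s)"
        by (intro bounded_rv_integrable bounded_rv_sum optimal_cost_bounded_rv)
      show "integrable M (\<lambda>x. (real m + C) * running_cost A B Q R T (noise x) (u T x) + real m * C)"
        using T by (intro Bochner_Integration.integrable_add integrable_mult_right
            integrable_running_cost) auto
    qed
    also have "\<dots> = (real m + C) * mean_cost T + real m * C"
      using T by (simp add: mean_cost_def integrable_running_cost prob_space)
    also have "\<dots> \<le> (real m + C + 1) * mean_cost T + real m * C"
      using mean_nonneg by (simp add: distrib_right)
    finally have "real m * ((real T - real (m + k + 1)) * L - C) \<le> (real m + C + 1) * mean_cost T"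
      by (simp add: right_diff_distrib)
    then have "real m / (real m + C + 1) * ((real T - real (m + k + 1)) * L - C) \<le> mean_cost T"
      using C by (simp add: field_simps)
    then have "real m / (real m + C + 1) * ((real T - real (m + k + 1)) * L - C) / real T
        \<le> mean_cost T / real T"
      by (rule divide_right_mono) simp
    moreover have "r * (y / q * L - C / q) = r * (y * L - C) / q" for r y q :: real
      by (simp add: diff_divide_distrib right_diff_distrib)
    ultimately show ?thesis
      by (simp only:)
  qed
  then show ?thesis
    using C by blast
qed

text \<open>
  For the bound from below T tends to infinity first, for a window length m that makes
  m / (m + C + 1) close enough to 1; for the bound from above T tends to infinity first, for a
  truncation N that makes the partial sum close enough to the series.
\<close>

theorem mean_cost_limit:
  "(\<lambda>T. mean_cost T / real T) \<longlonglongrightarrow> trace (W ** schur P) - suminf loss_term"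
proof -
  define L where "L = trace (W ** schur P) - suminf loss_term"
  have "eventually (\<lambda>T. a < mean_cost T / real T) sequentially" if a: "a < L" for a
  proof -
    obtain C where C: "C \<ge> 0" "\<And>m. \<exists>n. \<forall>T\<ge>n. real m / (real m + C + 1)
        * ((real T - real n) / real T * L - C / real T) \<le> mean_cost T / real T"
      using mean_cost_lower unfolding L_def by blast
    have "(\<lambda>m. real m / (real m + C + 1) * L) \<longlonglongrightarrow> 1 * L"
      by (intro tendsto_intros) real_asymp
    then have "eventually (\<lambda>m. a < real m / (real m + C + 1) * L) sequentially"
      using a by (intro order_tendstoD(1)) auto
    then obtain m where m: "a < real m / (real m + C + 1) * L"
      by (auto simp: eventually_sequentially)
    obtain n where n: "\<And>T. T \<ge> n \<Longrightarrow> real m / (real m + C + 1)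
        * ((real T - real n) / real T * L - C / real T) \<le> mean_cost T / real T"
      using C(2) by blast
    have "(\<lambda>T. (real T - real n) / real T) \<longlonglongrightarrow> 1"
      by real_asymp
    then have "(\<lambda>T. real m / (real m + C + 1) * ((real T - real n) / real T * L - C / real T))
        \<longlonglongrightarrow> real m / (real m + C + 1) * (1 * L - 0)"
      by (intro tendsto_mult tendsto_diff tendsto_const lim_const_over_n)
    then have "eventually (\<lambda>T. a < real m / (real m + C + 1)
        * ((real T - real n) / real T * L - C / real T)) sequentially"
      using m by (intro order_tendstoD(1)) auto
    then show ?thesis
      using eventually_ge_at_top[of n]
    proof eventually_elim
      case (elim T)
      with n[of T] show ?case
        by linarith
    qed
  qed
  moreover have "eventually (\<lambda>T. mean_cost T / real T < a) sequentially" if a: "L < a" for a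
  proof -
    have "(\<lambda>N. trace (W ** schur P) - (\<Sum>i<N. loss_term i)) \<longlonglongrightarrow> L"
      unfolding L_def by (intro tendsto_intros summable_LIMSEQ summable_loss)
    then have "eventually (\<lambda>N. trace (W ** schur P) - (\<Sum>i<N. loss_term i) < a) sequentially"
      using a by (intro order_tendstoD(2)) auto
    then obtain N where N: "trace (W ** schur P) - (\<Sum>i<N. loss_term i) < a"
      by (auto simp: eventually_sequentially)
    obtain g where g: "g \<longlonglongrightarrow> trace (W ** schur P) - (\<Sum>i<N. loss_term i)"
      "\<And>T. T \<ge> 1 \<Longrightarrow> mean_cost T / real T \<le> g T"
      using mean_cost_upper by blast
    have "eventually (\<lambda>T. g T < a) sequentially"
      using g(1) N by (rule order_tendstoD(2))
    then show ?thesis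
      using eventually_ge_at_top[of 1]
    proof eventually_elim
      case (elim T)
      with g(2)[of T] show ?case
        by linarith
    qed
  qed
  ultimately show ?thesis
    unfolding L_def[symmetric] by (rule order_tendstoI)
qed

end

end

section \<open>The infinite-horizon cost of the offline policy\<close>

lemma (in prob_space) iid_second_moments:
  fixes w :: "nat \<Rightarrow> 'a \<Rightarrow> real^'n"
  assumes indep: "indep_vars (\<lambda>_. borel) w UNIV"
    and dist: "\<And>t. distr M borel (w t) = D"
    and bdd: "\<And>t. bounded_rv (w t)"
    and mean: "(\<integral>x. x \<partial>D) = 0"
    and W: "W = (\<chi> i j. \<integral>x. x $ i * x $ j \<partial>D)"
  shows "expectation (\<lambda>x. (a \<bullet> w s x) * (c \<bullet> w t x)) = (if s = t then a \<bullet> (W *v c) else 0)"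
proof -
  have meas [measurable]: "w t \<in> borel_measurable M" for t
    by (rule bounded_rv_measurable[OF bdd])
  have int: "integrable M (\<lambda>x. a \<bullet> w t x)" for a t
    by (intro bounded_rv_integrable bounded_rv_inner bounded_rv_const bdd)
  show ?thesis
  proof (cases "s = t")
    case True
    have D_entry: "(\<integral>x. x $ i * x $ j \<partial>D) = expectation (\<lambda>x. w t x $ i * w t x $ j)" for i j
      unfolding dist[of t, symmetric] by (subst integral_distr) auto
    have int_entry: "integrable M (\<lambda>x. w t x $ i * w t x $ j)" for i j
      using bounded_rv_integrable[OF bounded_rv_mult[OF
          bounded_rv_inner[OF bdd[of t] bounded_rv_const[of "axis i 1"]]
          bounded_rv_inner[OF bdd[of t] bounded_rv_const[of "axis j 1"]]]]
      by (simp add: inner_axis)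
    have "(a \<bullet> w t x) * (c \<bullet> w t x)
        = (\<Sum>i\<in>UNIV. \<Sum>j\<in>UNIV. a $ i * c $ j * (w t x $ i * w t x $ j))" for x
      by (simp add: inner_vec_def sum_product mult_ac)
    then have "expectation (\<lambda>x. (a \<bullet> w t x) * (c \<bullet> w t x))
        = (\<Sum>i\<in>UNIV. \<Sum>j\<in>UNIV. a $ i * c $ j * W $ i $ j)"
      by (simp add: int_entry W D_entry)
    also have "\<dots> = a \<bullet> (W *v c)"
      by (simp add: inner_vec_def matrix_vector_mult_def sum_distrib_left mult_ac)
    finally show ?thesis
      using True by simp
  next
    case False
    have zero: "expectation (\<lambda>x. a \<bullet> w t x) = 0" for a t
    proof -
      have "expectation (w t) = (\<integral>x. x \<partial>D)"
        unfolding dist[of t, symmetric] by (subst integral_distr) auto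
      then show ?thesis
        using mean by (subst integral_inner_right) (auto intro: bounded_rv_integrable bdd)
    qed
    define X where "X = (\<lambda>i x. (if i = s then a else c) \<bullet> w i x)"
    have "indep_vars (\<lambda>_. borel) X {s, t}"
      unfolding X_def by (rule indep_vars_compose2[OF indep_vars_subset[OF indep]]) auto
    moreover have "integrable M (X i)" for i
      using int by (simp add: X_def)
    ultimately have "expectation (\<lambda>x. \<Prod>i\<in>{s, t}. X i x) = (\<Prod>i\<in>{s, t}. expectation (X i))"
      by (intro indep_vars_lebesgue_integral) auto
    then show ?thesis
      using False by (simp add: X_def zero)
  qed
qed

theorem theorem3:
  fixes A Q Qf P S W :: "real^'n^'n"
    and B :: "real^'m^'n"
    and R :: "real^'m^'m"
    and K :: "real^'n^'m"
    and M :: "'o measure"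
    and D :: "(real^'n) measure"
    and w :: "nat \<Rightarrow> 'o \<Rightarrow> real^'n"
    and ustar :: "nat \<Rightarrow> 'o \<Rightarrow> nat \<Rightarrow> real^'m"
  assumes "stabilizable A B"
    and "sym_psd Q" and "sym_psd Qf" and "sym_pd R"
    and "sym_psd P" and "riccati_eq A B Q R P"
    and "\<And>P'. sym_psd P' \<Longrightarrow> riccati_eq A B Q R P' \<Longrightarrow> P' = P"
    and "S = P - P ** B ** matrix_inv (R + transpose B ** P ** B) ** transpose B ** P"
    and "K = matrix_inv (R + transpose B ** P ** B) ** transpose B ** P ** A"
    and "prob_space M"
    and "prob_space.indep_vars M (\<lambda>_. borel) w UNIV"
    and "\<And>t. distr M borel (w t) = D"
    and "bounded (measure_support D)"
    and "(\<integral>x. x \<partial>D) = 0"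
    and "W = (\<chi> i j. \<integral>x. x $ i * x $ j \<partial>D)"
    and "\<And>T \<omega>. T \<ge> 1 \<Longrightarrow> \<omega> \<in> space M \<Longrightarrow>
           offline_optimal A B Q R Qf T (\<lambda>t. w t \<omega>) (ustar T \<omega>)"
  defines "term_i \<equiv> \<lambda>i. trace (W ** S ** A ** mat_pow (A - B ** K) i ** B
             ** matrix_inv (R + transpose B ** P ** B) ** transpose B
             ** mat_pow (transpose A - transpose K ** transpose B) i ** transpose A ** S)"
  shows "(\<forall>T\<ge>1. integrable M
            (\<lambda>\<omega>. 1 / real T * running_cost A B Q R T (\<lambda>t. w t \<omega>) (ustar T \<omega>)))
       \<and> summable term_i
       \<and> (\<lambda>T. \<integral>\<omega>. 1 / real T * running_cost A B Q R T (\<lambda>t. w t \<omega>) (ustar T \<omega>) \<partial>M)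
            \<longlonglongrightarrow> trace (W ** S) - (\<Sum>i. term_i i)"
proof -
  interpret prob_space M
    by fact
  have meas: "w t \<in> borel_measurable M" for t
    using assms(11) by (simp add: indep_vars_def)
  obtain b where b: "AE x in M. norm (w 0 x) \<le> b"
    using AE_in_bounded_support[OF meas, of 0] assms(12,13) by metis
  \<comment> \<open>Identical distribution makes one bound serve for all times.\<close>
  have b_all: "AE x in M. norm (w t x) \<le> b" for t
  proof -
    have "AE x in distr M borel (w 0). norm x \<le> b"
      using b by (subst AE_distr_iff) (auto simp: meas)
    then have "AE x in distr M borel (w t). norm x \<le> b"
      by (simp only: assms(12))
    then show ?thesis
      by (subst (asm) AE_distr_iff) (auto simp: meas)
  qed
  have bdd: "bounded_rv (w t)" for t
    using meas b_all by (auto simp: bounded_rv_def)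
  interpret lqr A B Q R
    using assms(2,4) by unfold_locales
  interpret lqr_white_noise A B Q R P M w W b
  proof unfold_locales
    show "stabilizable A B" "sym_psd P"
      by fact+
    show "riccati P = P" "\<And>X. sym_psd X \<Longrightarrow> riccati X = X \<Longrightarrow> X = P"
      using assms(6,7) unfolding riccati_eq_iff by blast+
    show "w t \<in> borel_measurable M" "AE x in M. norm (w t x) \<le> b" for t
      by (rule meas b_all)+
    show "expectation (\<lambda>x. (a \<bullet> w s x) * (c \<bullet> w t x)) = (if s = t then a \<bullet> (W *v c) else 0)"
      for s t a c
      by (rule iid_second_moments[OF assms(11,12) bdd assms(14,15)])
  qed
  have S: "S = schur P" and K: "K = gain P"
    by (simp_all add: assms(8,9) schur_def gain_def gram_def)
  have F: "A - B ** K = closed_loop P"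
    "transpose A - transpose K ** transpose B = transpose (closed_loop P)"
    by (simp_all add: K closed_loop_def transpose_diff matrix_transpose_mul)
  have "term_i i = loss_term i" for i
    unfolding assms(17) loss_term_def F S ctrl_def gram_def by (simp only: matrix_mul_assoc)
  then have loss: "term_i = loss_term"
    by auto
  have "integrable M (\<lambda>\<omega>. 1 / real T * running_cost A B Q R T (noise \<omega>) (ustar T \<omega>))" if "T \<ge> 1" for T
    using that by (intro integrable_mult_right integrable_running_cost[OF assms(3,16)])
  moreover have "(\<lambda>T. \<integral>\<omega>. 1 / real T * running_cost A B Q R T (noise \<omega>) (ustar T \<omega>) \<partial>M)
      \<longlonglongrightarrow> trace (W ** S) - (\<Sum>i. term_i i)"
    using mean_cost_limit[OF assms(3,16)]
    by (simp add: mean_cost_def[OF assms(3,16)] S loss)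
  ultimately show ?thesis
    using summable_loss[OF assms(3,16)] by (simp add: loss)
qed

end
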